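(* Let $K$ be a field of characteristic zero, $A_1$ the first Weyl algebra over $K$, $Q(A_1)$ its classical quotient division ring, and $\mathbb{A}_1$ the Jacobian algebra in one variable. Then $Q'(\mathbb{A}_1)\simeq Q(A_1)$.
   Context: All rings are unital. A subset $S$ of a ring $R$ is multiplicative if $1\in S$, $SS\subseteq S$, $0\notin S$. A multiplicative set $S$ is a right Ore set if $rS\cap sR\neq\emptyset$ for all $r\in R$, $s\in S$; it is a right denominator set if moreover $sr=0$ ($r\in R$, $s\in S$) implies $rt=0$ for some $t\in S$; $RS^{-1}$ is the right localization. $\mathcal{C}'_R=\{c\in R\mid cr=0\Rightarrow r=0\}$ is the set of right regular elements; it contains a largest right denominator set of $R$, denoted $S'(R)$, and $Q'(R):=R\,S'(R)^{-1}$ is the right regular right quotient ring of $R$. The symbol $\simeq$ denotes isomorphism of $K$-algebras. $A_1$ is the subalgebra of $\mathrm{End}_K(K[x])$ generated by multiplication by $x$ and $\partial=\frac{d}{dx}$. $\mathbb{A}_1$ is the subalgebra of $\mathrm{End}_K(K[x])$ generated by $A_1$ and the inverse $H^{-1}$ of the bijective map $H:=\partial x$ (so $H(x^k)=(k+1)x^k$). *)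

theory Defs
  imports "HOL-Algebra.Module" "HOL-Algebra.Subrings" "HOL-Computational_Algebra.Polynomial"
begin

text \<open>
  Associative, not necessarily commutative, \<open>K\<close>-algebras are represented by the record
  type \<open>('k, 'a) module\<close> with \<open>'k\<close> a type of class \<open>field\<close>.  Only the record is taken from
  HOL-Algebra: the locales \<open>module\<close> and \<open>algebra\<close> there are about commutative rings.
\<close>

section \<open>Right localization\<close>

definition multiplicative_set :: "('a, 'm) ring_scheme \<Rightarrow> 'a set \<Rightarrow> bool" where
  "multiplicative_set R S \<longleftrightarrow> submonoid S R \<and> \<zero>\<^bsub>R\<^esub> \<notin> S"

definition right_Ore_set :: "('a, 'm) ring_scheme \<Rightarrow> 'a set \<Rightarrow> bool" where
  "right_Ore_set R S \<longleftrightarrow> multiplicative_set R S \<and>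
     (\<forall>r\<in>carrier R. \<forall>s\<in>S. (r <#\<^bsub>R\<^esub> S) \<inter> (s <#\<^bsub>R\<^esub> carrier R) \<noteq> {})"

definition right_denominator_set :: "('a, 'm) ring_scheme \<Rightarrow> 'a set \<Rightarrow> bool" where
  "right_denominator_set R S \<longleftrightarrow> right_Ore_set R S \<and>
     (\<forall>r\<in>carrier R. \<forall>s\<in>S. s \<otimes>\<^bsub>R\<^esub> r = \<zero>\<^bsub>R\<^esub> \<longrightarrow> (\<exists>t\<in>S. r \<otimes>\<^bsub>R\<^esub> t = \<zero>\<^bsub>R\<^esub>))"

text \<open>The pair \<open>(r, s)\<close> stands for the right fraction \<open>r s\<^sup>-\<^sup>1\<close>; two fractions are identified
  if they can be brought to the same numerator over the same denominator in \<open>S\<close>.\<close>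

definition Ore_rel :: "('a, 'm) ring_scheme \<Rightarrow> 'a set \<Rightarrow> (('a \<times> 'a) \<times> ('a \<times> 'a)) set" where
  "Ore_rel R S = {((r, s), (r', s')).
     r \<in> carrier R \<and> s \<in> S \<and> r' \<in> carrier R \<and> s' \<in> S \<and>
     (\<exists>u\<in>carrier R. \<exists>v\<in>carrier R.
        r \<otimes>\<^bsub>R\<^esub> u = r' \<otimes>\<^bsub>R\<^esub> v \<and> s \<otimes>\<^bsub>R\<^esub> u = s' \<otimes>\<^bsub>R\<^esub> v \<and> s \<otimes>\<^bsub>R\<^esub> u \<in> S)}"

definition Ore_frac :: "('a, 'm) ring_scheme \<Rightarrow> 'a set \<Rightarrow> 'a \<Rightarrow> 'a \<Rightarrow> ('a \<times> 'a) set" where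
  "Ore_frac R S r s = Ore_rel R S `` {(r, s)}"

text \<open>The operations on \<open>R S\<^sup>-\<^sup>1\<close>.  If \<open>S\<close> is a right denominator set, the classes do not depend
  on the representatives and auxiliary elements selected by \<open>SOME\<close>.  The formulas are
  \<open>r\<^sub>1 s\<^sub>1\<^sup>-\<^sup>1 + r\<^sub>2 s\<^sub>2\<^sup>-\<^sup>1 = (r\<^sub>1 u + r\<^sub>2 v) (s\<^sub>1 u)\<^sup>-\<^sup>1\<close> for \<open>s\<^sub>1 u = s\<^sub>2 v \<in> S\<close>, and
  \<open>(r\<^sub>1 s\<^sub>1\<^sup>-\<^sup>1) (r\<^sub>2 s\<^sub>2\<^sup>-\<^sup>1) = (r\<^sub>1 q) (s\<^sub>2 t)\<^sup>-\<^sup>1\<close> for \<open>r\<^sub>2 t = s\<^sub>1 q\<close>, \<open>t \<in> S\<close>, that is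
  \<open>s\<^sub>1\<^sup>-\<^sup>1 r\<^sub>2 = q t\<^sup>-\<^sup>1\<close>.\<close>

definition Ore_add ::
  "('a, 'm) ring_scheme \<Rightarrow> 'a set \<Rightarrow> ('a \<times> 'a) set \<Rightarrow> ('a \<times> 'a) set \<Rightarrow> ('a \<times> 'a) set" where
  "Ore_add R S X Y = (SOME Z. \<exists>r\<^sub>1 s\<^sub>1 r\<^sub>2 s\<^sub>2 u v.
     (r\<^sub>1, s\<^sub>1) \<in> X \<and> (r\<^sub>2, s\<^sub>2) \<in> Y \<and> u \<in> carrier R \<and> v \<in> carrier R \<and>
     s\<^sub>1 \<otimes>\<^bsub>R\<^esub> u = s\<^sub>2 \<otimes>\<^bsub>R\<^esub> v \<and> s\<^sub>1 \<otimes>\<^bsub>R\<^esub> u \<in> S \<and>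
     Z = Ore_frac R S (r\<^sub>1 \<otimes>\<^bsub>R\<^esub> u \<oplus>\<^bsub>R\<^esub> r\<^sub>2 \<otimes>\<^bsub>R\<^esub> v) (s\<^sub>1 \<otimes>\<^bsub>R\<^esub> u))"

definition Ore_mult ::
  "('a, 'm) ring_scheme \<Rightarrow> 'a set \<Rightarrow> ('a \<times> 'a) set \<Rightarrow> ('a \<times> 'a) set \<Rightarrow> ('a \<times> 'a) set" where
  "Ore_mult R S X Y = (SOME Z. \<exists>r\<^sub>1 s\<^sub>1 r\<^sub>2 s\<^sub>2 q t.
     (r\<^sub>1, s\<^sub>1) \<in> X \<and> (r\<^sub>2, s\<^sub>2) \<in> Y \<and> q \<in> carrier R \<and> t \<in> S \<and>
     r\<^sub>2 \<otimes>\<^bsub>R\<^esub> t = s\<^sub>1 \<otimes>\<^bsub>R\<^esub> q \<and>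
     Z = Ore_frac R S (r\<^sub>1 \<otimes>\<^bsub>R\<^esub> q) (s\<^sub>2 \<otimes>\<^bsub>R\<^esub> t))"

definition Ore_smult ::
  "('k, 'a, 'm) module_scheme \<Rightarrow> 'a set \<Rightarrow> 'k \<Rightarrow> ('a \<times> 'a) set \<Rightarrow> ('a \<times> 'a) set" where
  "Ore_smult R S c X = (SOME Z. \<exists>r s. (r, s) \<in> X \<and> Z = Ore_frac R S (c \<odot>\<^bsub>R\<^esub> r) s)"

definition right_localization ::
  "('k, 'a, 'm) module_scheme \<Rightarrow> 'a set \<Rightarrow> ('k, ('a \<times> 'a) set) module" where
  "right_localization R S =
    \<lparr> carrier = (carrier R \<times> S) // Ore_rel R S,
      monoid.mult = Ore_mult R S,
      one = Ore_frac R S \<one>\<^bsub>R\<^esub> \<one>\<^bsub>R\<^esub>,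
      zero = Ore_frac R S \<zero>\<^bsub>R\<^esub> \<one>\<^bsub>R\<^esub>,
      add = Ore_add R S,
      module.smult = Ore_smult R S \<rparr>"

section \<open>Quotient rings\<close>

definition right_regular :: "('a, 'm) ring_scheme \<Rightarrow> 'a set" where
  "right_regular R =
    {c \<in> carrier R. \<forall>r\<in>carrier R. c \<otimes>\<^bsub>R\<^esub> r = \<zero>\<^bsub>R\<^esub> \<longrightarrow> r = \<zero>\<^bsub>R\<^esub>}"

definition regular :: "('a, 'm) ring_scheme \<Rightarrow> 'a set" where
  "regular R =
    {c \<in> right_regular R. \<forall>r\<in>carrier R. r \<otimes>\<^bsub>R\<^esub> c = \<zero>\<^bsub>R\<^esub> \<longrightarrow> r = \<zero>\<^bsub>R\<^esub>}"

text \<open>\<open>GREATEST\<close> is with respect to inclusion: \<open>S'(R)\<close> is the largest element, not just a maximal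
  one.\<close>

definition largest_right_regular_denominator_set :: "('a, 'm) ring_scheme \<Rightarrow> 'a set" where
  "largest_right_regular_denominator_set R =
    (GREATEST S. right_denominator_set R S \<and> S \<subseteq> right_regular R)"

definition right_regular_right_quotient_ring ::
  "('k, 'a, 'm) module_scheme \<Rightarrow> ('k, ('a \<times> 'a) set) module" where
  "right_regular_right_quotient_ring R =
    right_localization R (largest_right_regular_denominator_set R)"

definition classical_right_quotient_ring ::
  "('k, 'a, 'm) module_scheme \<Rightarrow> ('k, ('a \<times> 'a) set) module" where
  "classical_right_quotient_ring R = right_localization R (regular R)"

section \<open>Algebras\<close>

definition algebra_isomorphic ::
  "('k, 'a, 'm) module_scheme \<Rightarrow> ('k, 'b, 'n) module_scheme \<Rightarrow> bool" where
  "algebra_isomorphic A B \<longleftrightarrow>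
    (\<exists>h\<in>ring_iso A B. \<forall>c. \<forall>a\<in>carrier A. h (c \<odot>\<^bsub>A\<^esub> a) = c \<odot>\<^bsub>B\<^esub> h a)"

definition unital_subalgebra :: "('k, 'a, 'm) module_scheme \<Rightarrow> 'a set \<Rightarrow> bool" where
  "unital_subalgebra A B \<longleftrightarrow> subring B A \<and> (\<forall>c. \<forall>b\<in>B. c \<odot>\<^bsub>A\<^esub> b \<in> B)"

definition generated_subalgebra ::
  "('k, 'a, 'm) module_scheme \<Rightarrow> 'a set \<Rightarrow> ('k, 'a, 'm) module_scheme" where
  "generated_subalgebra A X = A\<lparr>carrier := unital_subalgebra A hull X\<rparr>"

section \<open>The Weyl algebra and the Jacobian algebra\<close>

type_synonym 'k poly_op = "'k poly \<Rightarrow> 'k poly"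

definition End_poly :: "('k::field, 'k poly_op) module" where
  "End_poly =
    \<lparr> carrier = {f. Vector_Spaces.linear Polynomial.smult Polynomial.smult f},
      monoid.mult = (\<circ>),
      one = id,
      zero = (\<lambda>p. 0),
      add = (\<lambda>f g p. f p + g p),
      module.smult = (\<lambda>c f p. Polynomial.smult c (f p)) \<rparr>"

definition X_op :: "'k::field poly_op" where
  "X_op p = [:0, 1:] * p"

definition H_op :: "'k::field poly_op" where
  "H_op = pderiv \<circ> X_op"

definition Weyl_algebra :: "('k::field, 'k poly_op) module" where
  "Weyl_algebra = generated_subalgebra End_poly {X_op, pderiv}"

text \<open>\<open>H_op\<close> is bijective in characteristic zero, so \<open>inv_into UNIV H_op\<close> is its two-sided inverse.\<close>

definition Jacobian_algebra :: "('k::field_char_0, 'k poly_op) module" where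
  "Jacobian_algebra = generated_subalgebra End_poly (carrier Weyl_algebra \<union> {inv_into UNIV H_op})"

end

theory Submission
  imports Defs
begin

text \<open>
  A nonzero element \<open>b\<close> of \<open>A\<^sub>1\<close> is injective on polynomials of large degree, so \<open>b x\<^sup>N\<close> is injective
  on \<open>K[x]\<close> for large \<open>N\<close>, and in particular is right regular in the Jacobian algebra \<open>J\<close>.  Moreover,
  every \<open>r \<in> J\<close> satisfies \<open>r b \<in> A\<^sub>1\<close> for some nonzero \<open>b \<in> A\<^sub>1\<close>: by the Ore condition in \<open>A\<^sub>1\<close> such
  operators form a subalgebra, and \<open>H\<^sup>-\<^sup>1\<close> is one of them.  So the Ore condition for all right
  regular elements of \<open>J\<close> reduces to that of \<open>A\<^sub>1\<close>, whence \<open>S'(J)\<close> consists of all of them, and every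
  fraction over \<open>J\<close> or \<open>A\<^sub>1\<close> can be written as \<open>a b\<^sup>-\<^sup>1\<close> with \<open>a, b \<in> A\<^sub>1\<close> and \<open>b\<close> injective.
\<close>

section \<open>Localization at right regular elements\<close>

text \<open>The obstacle is that J is not a domain. The operator e = 1 - x H^-1 \<partial> sends a
  polynomial to its constant term, so it is a nonzero element of J with \<partial> e = 0 and e x =
  0. Hence \<partial> is regular in A_1 but not right regular in J. Conversely, H^-1 is right
  regular in J but does not lie in A_1. Neither set of denominators contains the other, so the two
  localizations are compared through the intersection of these sets, and multiplication by a power
  of x serves to enter it. Moreover x is right regular in J, so e x = 0 makes e vanish in Q'(J): J
  does not embed into Q'(J), and elements of the denominator set can be cancelled on the left only.
  The arguments about fractions therefore always cancel a left factor.\<close>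

locale right_Ore_regular = ring R for R (structure) +
  fixes S
  assumes Ore_set: "right_Ore_set R S"
    and regular: "S \<subseteq> right_regular R"
begin

lemma S_closed [simp]: "s \<in> S \<Longrightarrow> s \<in> carrier R"
  using regular by (auto simp: right_regular_def)

lemma S_one [simp]: "\<one> \<in> S"
  using Ore_set by (simp add: right_Ore_set_def multiplicative_set_def submonoid_def)

lemma S_mult [simp]: "s \<in> S \<Longrightarrow> t \<in> S \<Longrightarrow> s \<otimes> t \<in> S"
  using Ore_set by (simp add: right_Ore_set_def multiplicative_set_def submonoid_def)

lemma Ore:
  assumes "r \<in> carrier R" "s \<in> S"
  obtains t q where "t \<in> S" "q \<in> carrier R" "r \<otimes> t = s \<otimes> q"
proof -
  have "(r <# S) \<inter> (s <# carrier R) \<noteq> {}"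
    using Ore_set assms unfolding right_Ore_set_def by blast
  then show ?thesis
    using that unfolding l_coset_def by blast
qed

text \<open>Right regularity concerns left factors: from
  \<open>x \<otimes> s = y \<otimes> s\<close> nothing follows in general.\<close>

lemma S_cancel:
  assumes "s \<in> S" "x \<in> carrier R" "y \<in> carrier R" "s \<otimes> x = s \<otimes> y"
  shows "x = y"
proof -
  have "s \<otimes> (x \<ominus> y) = \<zero>"
    using assms S_closed by (simp add: a_minus_def r_distr r_minus r_neg)
  then have "x \<ominus> y = \<zero>"
    using assms(1-3) regular unfolding right_regular_def by blast
  then show ?thesis
    using assms(2,3) by simp
qed

lemma common_multiple:
  assumes "s \<in> S" "s' \<in> S"
  obtains u v where "u \<in> S" "v \<in> carrier R" "s \<otimes> u = s' \<otimes> v"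
  using Ore[of s s'] assms by auto

lemma Ore_relI:
  assumes "r \<in> carrier R" "s \<in> S" "r' \<in> carrier R" "s' \<in> S" "u \<in> carrier R" "v \<in> carrier R"
    "r \<otimes> u = r' \<otimes> v" "s \<otimes> u = s' \<otimes> v" "s \<otimes> u \<in> S"
  shows "((r, s), (r', s')) \<in> Ore_rel R S"
  unfolding Ore_rel_def using assms by blast

lemma Ore_relE:
  assumes "((r, s), (r', s')) \<in> Ore_rel R S"
  obtains u v where "r \<in> carrier R" "s \<in> S" "r' \<in> carrier R" "s' \<in> S"
    "u \<in> carrier R" "v \<in> carrier R"
    "r \<otimes> u = r' \<otimes> v" "s \<otimes> u = s' \<otimes> v" "s \<otimes> u \<in> S"
  using assms by (auto simp: Ore_rel_def)

lemma equiv_Ore_rel: "equiv (carrier R \<times> S) (Ore_rel R S)"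
proof (rule equivI)
  show "Ore_rel R S \<subseteq> (carrier R \<times> S) \<times> (carrier R \<times> S)"
    by (auto simp: Ore_rel_def)
  show "refl_on (carrier R \<times> S) (Ore_rel R S)"
    by (auto simp: refl_on_def intro: Ore_relI[of _ _ _ _ \<one> \<one>])
  show "sym (Ore_rel R S)"
  proof (rule symI, clarify)
    fix r s r' s' assume "((r, s), (r', s')) \<in> Ore_rel R S"
    then obtain u v where "r \<in> carrier R" "s \<in> S" "r' \<in> carrier R" "s' \<in> S"
      "u \<in> carrier R" "v \<in> carrier R" "r \<otimes> u = r' \<otimes> v" "s \<otimes> u = s' \<otimes> v" "s \<otimes> u \<in> S"
      by (rule Ore_relE)
    then show "((r', s'), (r, s)) \<in> Ore_rel R S"
      by (intro Ore_relI[of _ _ _ _ v u]) simp_all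
  qed
  show "trans (Ore_rel R S)"
  proof (rule transI, clarify)
    fix r s r' s' r'' s''
    assume "((r, s), (r', s')) \<in> Ore_rel R S"
    then obtain u v where 1: "r \<in> carrier R" "s \<in> S" "r' \<in> carrier R" "s' \<in> S"
      "u \<in> carrier R" "v \<in> carrier R" "r \<otimes> u = r' \<otimes> v" "s \<otimes> u = s' \<otimes> v" "s \<otimes> u \<in> S"
      by (rule Ore_relE)
    assume "((r', s'), (r'', s'')) \<in> Ore_rel R S"
    then obtain u' v' where 2: "r'' \<in> carrier R" "s'' \<in> S" "u' \<in> carrier R" "v' \<in> carrier R"
      "r' \<otimes> u' = r'' \<otimes> v'" "s' \<otimes> u' = s'' \<otimes> v'" "s' \<otimes> u' \<in> S"
      by (rule Ore_relE)
    \<comment> \<open>The middle denominator occurs as \<open>s' \<otimes> v\<close> and as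
      \<open>s' \<otimes> u'\<close>. A common multiple of the two, with \<open>s'\<close>
      cancelled, gives \<open>v \<otimes> p = u' \<otimes> q\<close>, which carries the numerators
      along.\<close>
    obtain p q where p: "p \<in> S" "q \<in> carrier R" "s' \<otimes> v \<otimes> p = s' \<otimes> u' \<otimes> q"
      using Ore[of "s' \<otimes> v" "s' \<otimes> u'"] 1 2 by auto
    have vp: "v \<otimes> p = u' \<otimes> q"
      by (rule S_cancel[of s']) (use 1 2 p in \<open>simp_all add: m_assoc[symmetric]\<close>)
    have "r \<otimes> u \<otimes> p = r'' \<otimes> v' \<otimes> q"
      using 1 2 p vp by (metis S_closed m_assoc)
    moreover have "s \<otimes> u \<otimes> p = s'' \<otimes> v' \<otimes> q"
      using 1 2 p by metis
    moreover have "s \<otimes> u \<otimes> p \<in> S"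
      by (rule S_mult[OF 1(9) p(1)])
    ultimately show "((r, s), (r'', s'')) \<in> Ore_rel R S"
      using 1 2 p by (intro Ore_relI[of _ _ _ _ "u \<otimes> p" "v' \<otimes> q"]) (simp_all add: m_assoc[symmetric])
  qed
qed

lemma Ore_frac_eq_iff:
  assumes "r \<in> carrier R" "s \<in> S" "r' \<in> carrier R" "s' \<in> S"
  shows "Ore_frac R S r s = Ore_frac R S r' s' \<longleftrightarrow> ((r, s), (r', s')) \<in> Ore_rel R S"
  using eq_equiv_class_iff[OF equiv_Ore_rel, of "(r, s)" "(r', s')"] assms
  by (simp add: Ore_frac_def)

lemma Ore_frac_eqI:
  assumes "r \<in> carrier R" "s \<in> S" "r' \<in> carrier R" "s' \<in> S" "u \<in> carrier R" "v \<in> carrier R"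
    "r \<otimes> u = r' \<otimes> v" "s \<otimes> u = s' \<otimes> v" "s \<otimes> u \<in> S"
  shows "Ore_frac R S r s = Ore_frac R S r' s'"
  using assms Ore_relI[of r s r' s' u v] by (simp add: Ore_frac_eq_iff)

text \<open>\<open>w\<close> may lie outside \<open>S\<close> as long as the new denominator is in
  \<open>S\<close>; the elements that later clear denominators are of this kind.\<close>

lemma Ore_frac_reduce:
  assumes "r \<in> carrier R" "s \<in> S" "w \<in> carrier R" "s \<otimes> w \<in> S"
  shows "Ore_frac R S (r \<otimes> w) (s \<otimes> w) = Ore_frac R S r s"
  using assms by (intro Ore_frac_eqI[of _ _ _ _ \<one> w]) auto

lemma in_Ore_frac_iff:
  assumes "r \<in> carrier R" "s \<in> S"
  shows "(r', s') \<in> Ore_frac R S r s \<longleftrightarrow> ((r, s), (r', s')) \<in> Ore_rel R S"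
  by (simp add: Ore_frac_def)

lemma in_Ore_frac_self:
  assumes "r \<in> carrier R" "s \<in> S"
  shows "(r, s) \<in> Ore_frac R S r s"
  using assms equiv_class_self[OF equiv_Ore_rel, of "(r, s)"] by (simp add: Ore_frac_def)

section \<open>Well-definedness of sums and products of fractions\<close>

lemma add_well_defined:
  assumes 1: "((r1, s1), (r1', s1')) \<in> Ore_rel R S"
    and 2: "((r2, s2), (r2', s2')) \<in> Ore_rel R S"
    and uv: "u \<in> carrier R" "v \<in> carrier R" "s1 \<otimes> u = s2 \<otimes> v" "s1 \<otimes> u \<in> S"
    and uv': "u' \<in> carrier R" "v' \<in> carrier R" "s1' \<otimes> u' = s2' \<otimes> v'" "s1' \<otimes> u' \<in> S"
  shows "Ore_frac R S (r1 \<otimes> u \<oplus> r2 \<otimes> v) (s1 \<otimes> u) = Ore_frac R S (r1' \<otimes> u' \<oplus> r2' \<otimes> v') (s1' \<otimes> u')"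
proof -
  obtain a b where ab: "r1 \<in> carrier R" "s1 \<in> S" "r1' \<in> carrier R" "s1' \<in> S"
    "a \<in> carrier R" "b \<in> carrier R" "r1 \<otimes> a = r1' \<otimes> b" "s1 \<otimes> a = s1' \<otimes> b" "s1 \<otimes> a \<in> S"
    using 1 by (rule Ore_relE)
  obtain c d where cd: "r2 \<in> carrier R" "s2 \<in> S" "r2' \<in> carrier R" "s2' \<in> S"
    "c \<in> carrier R" "d \<in> carrier R" "r2 \<otimes> c = r2' \<otimes> d" "s2 \<otimes> c = s2' \<otimes> d" "s2 \<otimes> c \<in> S"
    using 2 by (rule Ore_relE)
  \<comment> \<open>Three Ore steps build one common right multiple of
    \<open>s1 \<otimes> u\<close>, \<open>s1 \<otimes> a\<close>, \<open>s2 \<otimes> c\<close> and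
    \<open>s1' \<otimes> u'\<close>. Cancelling \<open>s1\<close>, \<open>s2\<close>,
    \<open>s1'\<close>, \<open>s2'\<close> on the left then relates the cofactors, and through them
    the numerators.\<close>
  obtain f g where fg: "f \<in> S" "g \<in> carrier R" "s1 \<otimes> u \<otimes> f = s1 \<otimes> a \<otimes> g"
    using common_multiple uv(4) ab(9) .
  obtain h k where hk: "h \<in> S" "k \<in> carrier R" "s1 \<otimes> u \<otimes> f \<otimes> h = s2 \<otimes> c \<otimes> k"
    using common_multiple[OF S_mult[OF uv(4) fg(1)] cd(9)] .
  obtain m n where mn: "m \<in> S" "n \<in> carrier R" "s1 \<otimes> u \<otimes> f \<otimes> h \<otimes> m = s1' \<otimes> u' \<otimes> n"
    using common_multiple[OF S_mult[OF S_mult[OF uv(4) fg(1)] hk(1)] uv'(4)] .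
  note cl = uv(1,2) uv'(1,2) ab(1-6) cd(1-6) fg(1,2) hk(1,2) mn(1,2)
  define \<alpha> where "\<alpha> = f \<otimes> (h \<otimes> m)"
  define \<beta> where "\<beta> = g \<otimes> (h \<otimes> m)"
  define \<gamma> where "\<gamma> = k \<otimes> m"
  have gr: "\<alpha> \<in> S" "\<beta> \<in> carrier R" "\<gamma> \<in> carrier R"
    using cl by (simp_all add: \<alpha>_def \<beta>_def \<gamma>_def)
  note cl = cl gr
  have e1: "s1 \<otimes> u \<otimes> \<alpha> = s1 \<otimes> a \<otimes> \<beta>"
    using cl fg(3) by (simp add: \<alpha>_def \<beta>_def m_assoc[symmetric])
  have e2: "s1 \<otimes> u \<otimes> \<alpha> = s2 \<otimes> c \<otimes> \<gamma>"
    using cl hk(3) by (simp add: \<alpha>_def \<gamma>_def m_assoc[symmetric])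
  have e3: "s1 \<otimes> u \<otimes> \<alpha> = s1' \<otimes> u' \<otimes> n"
    using cl mn(3) by (simp add: \<alpha>_def m_assoc[symmetric])
  have E: "u \<otimes> \<alpha> = a \<otimes> \<beta>" "v \<otimes> \<alpha> = c \<otimes> \<gamma>" "u' \<otimes> n = b \<otimes> \<beta>" "v' \<otimes> n = d \<otimes> \<gamma>"
    subgoal using cl e1 by - (rule S_cancel[of s1], simp_all add: m_assoc)
    subgoal using cl e2 uv(3) by - (rule S_cancel[of s2], simp_all add: m_assoc[symmetric])
    subgoal using cl e1 e3 ab(8) by - (rule S_cancel[of s1'], simp_all add: m_assoc[symmetric])
    subgoal using cl e2 e3 cd(8) uv'(3) by - (rule S_cancel[of s2'], simp_all add: m_assoc[symmetric])
    done
  have "r1 \<otimes> u \<otimes> \<alpha> = r1' \<otimes> u' \<otimes> n"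
    using cl E ab(7) by (metis S_closed m_assoc)
  moreover have "r2 \<otimes> v \<otimes> \<alpha> = r2' \<otimes> v' \<otimes> n"
    using cl E cd(7) by (metis S_closed m_assoc)
  moreover have "s1' \<otimes> u' \<otimes> n \<in> S"
    using S_mult[OF uv(4) gr(1)] e3 by simp
  ultimately show ?thesis
    using cl uv(4) uv'(4) e3
    by (intro Ore_frac_eqI[of _ _ _ _ \<alpha> n]) (simp_all add: l_distr)
qed

lemma mult_well_defined:
  assumes 1: "((r1, s1), (r1', s1')) \<in> Ore_rel R S"
    and 2: "((r2, s2), (r2', s2')) \<in> Ore_rel R S"
    and qt: "q \<in> carrier R" "t \<in> S" "r2 \<otimes> t = s1 \<otimes> q"
    and qt': "q' \<in> carrier R" "t' \<in> S" "r2' \<otimes> t' = s1' \<otimes> q'"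
  shows "Ore_frac R S (r1 \<otimes> q) (s2 \<otimes> t) = Ore_frac R S (r1' \<otimes> q') (s2' \<otimes> t')"
proof -
  obtain a b where ab: "r1 \<in> carrier R" "s1 \<in> S" "r1' \<in> carrier R" "s1' \<in> S"
    "a \<in> carrier R" "b \<in> carrier R" "r1 \<otimes> a = r1' \<otimes> b" "s1 \<otimes> a = s1' \<otimes> b" "s1 \<otimes> a \<in> S"
    using 1 by (rule Ore_relE)
  obtain c d where cd: "r2 \<in> carrier R" "s2 \<in> S" "r2' \<in> carrier R" "s2' \<in> S"
    "c \<in> carrier R" "d \<in> carrier R" "r2 \<otimes> c = r2' \<otimes> d" "s2 \<otimes> c = s2' \<otimes> d" "s2 \<otimes> c \<in> S"
    using 2 by (rule Ore_relE)
  obtain f g where fg: "f \<in> S" "g \<in> carrier R" "s2 \<otimes> t \<otimes> f = s2 \<otimes> c \<otimes> g"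
    using common_multiple[OF S_mult[OF cd(2) qt(2)] cd(9)] .
  obtain m n where mn: "m \<in> S" "n \<in> carrier R" "s2 \<otimes> t \<otimes> f \<otimes> m = s2' \<otimes> t' \<otimes> n"
    using common_multiple[OF S_mult[OF S_mult[OF cd(2) qt(2)] fg(1)] S_mult[OF cd(4) qt'(2)]] .
  note cl = qt(1,2) qt'(1,2) ab(1-6) cd(1-6) fg(1,2) mn(1,2)
  define \<alpha> where "\<alpha> = f \<otimes> m"
  define \<gamma> where "\<gamma> = g \<otimes> m"
  have gr: "\<alpha> \<in> S" "\<gamma> \<in> carrier R"
    using cl by (simp_all add: \<alpha>_def \<gamma>_def)
  note cl = cl gr
  have e1: "s2 \<otimes> t \<otimes> \<alpha> = s2 \<otimes> c \<otimes> \<gamma>"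
    using cl fg(3) by (simp add: \<alpha>_def \<gamma>_def m_assoc[symmetric])
  have e2: "s2 \<otimes> t \<otimes> \<alpha> = s2' \<otimes> t' \<otimes> n"
    using cl mn(3) by (simp add: \<alpha>_def m_assoc[symmetric])
  have E: "t \<otimes> \<alpha> = c \<otimes> \<gamma>" "t' \<otimes> n = d \<otimes> \<gamma>"
    subgoal using cl e1 by - (rule S_cancel[of s2], simp_all add: m_assoc)
    subgoal using cl e1 e2 cd(8) by - (rule S_cancel[of s2'], simp_all add: m_assoc[symmetric])
    done
  have r2: "r2 \<otimes> t \<otimes> \<alpha> = r2' \<otimes> t' \<otimes> n"
    using cl E cd(7) by (metis S_closed m_assoc)
  \<comment> \<open>\<open>r1\<close> and \<open>r1'\<close> are only known to agree after
    multiplication by \<open>a\<close> and \<open>b\<close>, so \<open>q \<otimes> \<alpha>\<close>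
    has to become a right multiple of \<open>a\<close>; this costs the further factor
    \<open>p\<close>.\<close>
  obtain p w where pw: "p \<in> S" "w \<in> carrier R" "s1 \<otimes> (q \<otimes> \<alpha>) \<otimes> p = s1 \<otimes> a \<otimes> w"
    using Ore[OF _ ab(9)] cl by (metis S_closed m_closed)
  note cl = cl pw(1,2)
  have e3: "s1 \<otimes> (q \<otimes> \<alpha>) \<otimes> p = s1' \<otimes> (q' \<otimes> n) \<otimes> p"
    using cl r2 qt(3) qt'(3) by (simp add: m_assoc[symmetric])
  have "q \<otimes> \<alpha> \<otimes> p = a \<otimes> w"
    using cl pw(3) by - (rule S_cancel[of s1], simp_all add: m_assoc)
  moreover have "q' \<otimes> n \<otimes> p = b \<otimes> w"
    using cl pw(3) e3 ab(8) by - (rule S_cancel[of s1'], simp_all add: m_assoc[symmetric])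
  ultimately have "r1 \<otimes> (q \<otimes> \<alpha> \<otimes> p) = r1' \<otimes> (q' \<otimes> n \<otimes> p)"
    using cl ab(7) by (metis m_assoc)
  moreover have "s2 \<otimes> t \<otimes> (\<alpha> \<otimes> p) = s2' \<otimes> t' \<otimes> (n \<otimes> p)"
    using cl e2 by (metis S_closed S_mult m_assoc)
  moreover have "s2 \<otimes> t \<otimes> (\<alpha> \<otimes> p) \<in> S"
    using cl by simp
  ultimately show ?thesis
    using cl by - (rule Ore_frac_eqI[of _ _ _ _ "\<alpha> \<otimes> p" "n \<otimes> p"], simp_all add: m_assoc)
qed

text \<open>\<open>SOME\<close> may pick any representatives and any cofactors, which is why
  \<open>add_well_defined\<close> varies all of them at once.\<close>

lemma Ore_add_frac:
  assumes "r1 \<in> carrier R" "s1 \<in> S" "r2 \<in> carrier R" "s2 \<in> S"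
    and "u \<in> carrier R" "v \<in> carrier R" "s1 \<otimes> u = s2 \<otimes> v" "s1 \<otimes> u \<in> S"
  shows "Ore_add R S (Ore_frac R S r1 s1) (Ore_frac R S r2 s2)
    = Ore_frac R S (r1 \<otimes> u \<oplus> r2 \<otimes> v) (s1 \<otimes> u)"
  unfolding Ore_add_def
proof (rule some_equality)
  show "\<exists>r1' s1' r2' s2' u' v'.
     (r1', s1') \<in> Ore_frac R S r1 s1 \<and> (r2', s2') \<in> Ore_frac R S r2 s2 \<and> u' \<in> carrier R \<and> v' \<in> carrier R \<and>
     s1' \<otimes> u' = s2' \<otimes> v' \<and> s1' \<otimes> u' \<in> S \<and>
     Ore_frac R S (r1 \<otimes> u \<oplus> r2 \<otimes> v) (s1 \<otimes> u) = Ore_frac R S (r1' \<otimes> u' \<oplus> r2' \<otimes> v') (s1' \<otimes> u')"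
    using assms in_Ore_frac_self by blast
next
  fix Z
  assume "\<exists>r1' s1' r2' s2' u' v'.
     (r1', s1') \<in> Ore_frac R S r1 s1 \<and> (r2', s2') \<in> Ore_frac R S r2 s2 \<and> u' \<in> carrier R \<and> v' \<in> carrier R \<and>
     s1' \<otimes> u' = s2' \<otimes> v' \<and> s1' \<otimes> u' \<in> S \<and>
     Z = Ore_frac R S (r1' \<otimes> u' \<oplus> r2' \<otimes> v') (s1' \<otimes> u')"
  then obtain r1' s1' r2' s2' u' v'
    where "(r1', s1') \<in> Ore_frac R S r1 s1" "(r2', s2') \<in> Ore_frac R S r2 s2"
      "u' \<in> carrier R" "v' \<in> carrier R" "s1' \<otimes> u' = s2' \<otimes> v'" "s1' \<otimes> u' \<in> S"
      and Z: "Z = Ore_frac R S (r1' \<otimes> u' \<oplus> r2' \<otimes> v') (s1' \<otimes> u')"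
    by blast
  then show "Z = Ore_frac R S (r1 \<otimes> u \<oplus> r2 \<otimes> v) (s1 \<otimes> u)"
    unfolding Z using assms add_well_defined[of r1 s1 r1' s1' r2 s2 r2' s2' u v u' v']
    by (simp add: in_Ore_frac_iff)
qed

lemma Ore_mult_frac:
  assumes "r1 \<in> carrier R" "s1 \<in> S" "r2 \<in> carrier R" "s2 \<in> S"
    and "q \<in> carrier R" "t \<in> S" "r2 \<otimes> t = s1 \<otimes> q"
  shows "Ore_mult R S (Ore_frac R S r1 s1) (Ore_frac R S r2 s2)
    = Ore_frac R S (r1 \<otimes> q) (s2 \<otimes> t)"
  unfolding Ore_mult_def
proof (rule some_equality)
  show "\<exists>r1' s1' r2' s2' q' t'.
     (r1', s1') \<in> Ore_frac R S r1 s1 \<and> (r2', s2') \<in> Ore_frac R S r2 s2 \<and> q' \<in> carrier R \<and> t' \<in> S \<and>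
     r2' \<otimes> t' = s1' \<otimes> q' \<and>
     Ore_frac R S (r1 \<otimes> q) (s2 \<otimes> t) = Ore_frac R S (r1' \<otimes> q') (s2' \<otimes> t')"
    using assms in_Ore_frac_self by blast
next
  fix Z
  assume "\<exists>r1' s1' r2' s2' q' t'.
     (r1', s1') \<in> Ore_frac R S r1 s1 \<and> (r2', s2') \<in> Ore_frac R S r2 s2 \<and> q' \<in> carrier R \<and> t' \<in> S \<and>
     r2' \<otimes> t' = s1' \<otimes> q' \<and> Z = Ore_frac R S (r1' \<otimes> q') (s2' \<otimes> t')"
  then obtain r1' s1' r2' s2' q' t'
    where "(r1', s1') \<in> Ore_frac R S r1 s1" "(r2', s2') \<in> Ore_frac R S r2 s2"
      "q' \<in> carrier R" "t' \<in> S" "r2' \<otimes> t' = s1' \<otimes> q'"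
      and Z: "Z = Ore_frac R S (r1' \<otimes> q') (s2' \<otimes> t')"
    by blast
  then show "Z = Ore_frac R S (r1 \<otimes> q) (s2 \<otimes> t)"
    unfolding Z using assms mult_well_defined[of r1 s1 r1' s1' r2 s2 r2' s2' q t q' t']
    by (simp add: in_Ore_frac_iff)
qed

end

text \<open>Stated outside the locale, whose \<open>R\<close> is a plain ring record without
  scalars. \<open>assoc\<close> lets a scalar pass a right cofactor, so it preserves the equality of
  numerators that defines \<open>Ore_rel\<close>.\<close>

lemma Ore_smult_frac:
  fixes R :: "('k, 'a, 'm) module_scheme" (structure)
  assumes "right_Ore_regular R S"
    and closed: "\<And>c x. x \<in> carrier R \<Longrightarrow> c \<odot> x \<in> carrier R"
    and assoc: "\<And>c x y. x \<in> carrier R \<Longrightarrow> y \<in> carrier R \<Longrightarrow> c \<odot> x \<otimes> y = c \<odot> (x \<otimes> y)"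
    and rs: "r \<in> carrier R" "s \<in> S"
  shows "Ore_smult R S c (Ore_frac R S r s) = Ore_frac R S (c \<odot> r) s"
proof -
  interpret right_Ore_regular R S by fact
  show ?thesis
    unfolding Ore_smult_def
  proof (rule some_equality)
    show "\<exists>r' s'. (r', s') \<in> Ore_frac R S r s \<and> Ore_frac R S (c \<odot> r) s = Ore_frac R S (c \<odot> r') s'"
      using rs in_Ore_frac_self by blast
  next
    fix Z
    assume "\<exists>r' s'. (r', s') \<in> Ore_frac R S r s \<and> Z = Ore_frac R S (c \<odot> r') s'"
    then obtain r' s' where r': "((r, s), (r', s')) \<in> Ore_rel R S" "Z = Ore_frac R S (c \<odot> r') s'"
      using rs by (auto simp: in_Ore_frac_iff)
    obtain u v where "r' \<in> carrier R" "s' \<in> S" "u \<in> carrier R" "v \<in> carrier R"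
      "r \<otimes> u = r' \<otimes> v" "s \<otimes> u = s' \<otimes> v" "s \<otimes> u \<in> S"
      using r'(1) by (rule Ore_relE)
    then have "Ore_frac R S (c \<odot> r) s = Ore_frac R S (c \<odot> r') s'"
      using rs by (intro Ore_frac_eqI[of _ _ _ _ u v]) (auto simp: assoc closed)
    with r'(2) show "Z = Ore_frac R S (c \<odot> r) s" by simp
  qed
qed

section \<open>Comparing the localizations of a ring and of a subring\<close>

lemma right_localization_carrierE:
  assumes "X \<in> carrier (right_localization R S)"
  obtains r s where "r \<in> carrier R" "s \<in> S" "X = Ore_frac R S r s"
  using assms by (auto simp: right_localization_def Ore_frac_def elim!: quotientE)

lemma Ore_frac_in_carrier:
  assumes "r \<in> carrier R" "s \<in> S"
  shows "Ore_frac R S r s \<in> carrier (right_localization R S)"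
  using assms by (auto simp: right_localization_def Ore_frac_def intro!: quotientI)

text \<open>Every fraction of either localization has a representative whose numerator lies in \<open>B\<close> and
  whose denominator lies in \<open>S \<inter> T\<close>; on such representatives both relations and all operations
  agree.\<close>

theorem right_localization_subring_iso:
  fixes R :: "('k, 'a, 'm) module_scheme" (structure)
  assumes RS: "right_Ore_regular R S"
    and B: "subring B R"
    and BT: "right_Ore_regular (R\<lparr>carrier := B\<rparr>) T"
    and smult_R: "\<And>c x. x \<in> carrier R \<Longrightarrow> c \<odot> x \<in> carrier R"
    and smult_B: "\<And>c x. x \<in> B \<Longrightarrow> c \<odot> x \<in> B"
    and assoc: "\<And>c x y. x \<in> carrier R \<Longrightarrow> y \<in> carrier R \<Longrightarrow> c \<odot> x \<otimes> y = c \<odot> (x \<otimes> y)"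
    and clear: "\<And>r s. r \<in> carrier R \<Longrightarrow> s \<in> S \<Longrightarrow> \<exists>b\<in>B. r \<otimes> b \<in> B \<and> s \<otimes> b \<in> S \<inter> T"
    and common: "\<And>t. t \<in> T \<Longrightarrow> \<exists>b\<in>B. t \<otimes> b \<in> S \<inter> T"
  shows "algebra_isomorphic (right_localization R S) (right_localization (R\<lparr>carrier := B\<rparr>) T)"
proof -
  define B' where "B' = R\<lparr>carrier := B\<rparr>"
  have B'_simps: "carrier B' = B" "x \<otimes>\<^bsub>B'\<^esub> y = x \<otimes> y" "x \<oplus>\<^bsub>B'\<^esub> y = x \<oplus> y"
    "c \<odot>\<^bsub>B'\<^esub> x = c \<odot> x" "\<one>\<^bsub>B'\<^esub> = \<one>" "\<zero>\<^bsub>B'\<^esub> = \<zero>" for c x y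
    by (simp_all add: B'_def)
  interpret R: right_Ore_regular R S by fact
  interpret B': right_Ore_regular B' T using BT by (simp add: B'_def)
  note Bs = subringE[OF B]
  note BR = subsetD[OF Bs(1)]
  have TB: "t \<in> T \<Longrightarrow> t \<in> B" for t
    using B'.S_closed by (simp add: B'_simps)
  define N where "N = S \<inter> T"
  have N: "n \<in> N \<Longrightarrow> n \<in> S" "n \<in> N \<Longrightarrow> n \<in> T" for n by (auto simp: N_def)
  have N_mult: "m \<in> N \<Longrightarrow> n \<in> N \<Longrightarrow> m \<otimes> n \<in> N" for m n
    using B'.S_mult by (auto simp: N_def B'_simps)

  have rel_iff: "((a, n), (a', n')) \<in> Ore_rel R S \<longleftrightarrow> ((a, n), (a', n')) \<in> Ore_rel B' T"
    if "a \<in> B" "n \<in> N" "a' \<in> B" "n' \<in> N" for a n a' n'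
  proof
    assume "((a, n), (a', n')) \<in> Ore_rel R S"
    then obtain u v where uv: "u \<in> carrier R" "v \<in> carrier R" "a \<otimes> u = a' \<otimes> v"
      "n \<otimes> u = n' \<otimes> v" "n \<otimes> u \<in> S"
      by (rule R.Ore_relE)
    \<comment> \<open>\<open>u\<close> and \<open>v\<close> must enter \<open>B\<close> through one
      common right factor. The first use of \<open>clear\<close> treats \<open>u\<close> over
      \<open>n \<otimes> u\<close>; the second treats \<open>v \<otimes> w\<close> over the
      denominator just obtained, and \<open>u \<otimes> w \<otimes> w'\<close> stays in
      \<open>B\<close>.\<close>
    obtain w where w: "w \<in> B" "u \<otimes> w \<in> B" "n \<otimes> u \<otimes> w \<in> N"
      using clear[OF uv(1,5)] by (auto simp: N_def)
    obtain w' where w': "w' \<in> B" "v \<otimes> w \<otimes> w' \<in> B" "n \<otimes> u \<otimes> w \<otimes> w' \<in> N"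
      using clear[OF _ N(1)[OF w(3)], of "v \<otimes> w"] uv(2) w(1) BR by (auto simp: N_def)
    have cl: "a \<in> carrier R" "a' \<in> carrier R" "n \<in> carrier R" "n' \<in> carrier R"
      "w \<in> carrier R" "w' \<in> carrier R"
      using that w(1) w'(1) BR N by auto
    have "a \<otimes> (u \<otimes> w \<otimes> w') = a' \<otimes> (v \<otimes> w \<otimes> w')" "n \<otimes> (u \<otimes> w \<otimes> w') = n' \<otimes> (v \<otimes> w \<otimes> w')"
      "n \<otimes> (u \<otimes> w \<otimes> w') \<in> T"
      using cl uv w'(3) N(2) by (simp_all add: R.m_assoc[symmetric])
    then show "((a, n), (a', n')) \<in> Ore_rel B' T"
      using that N(2) w w' Bs(6)
      by (intro B'.Ore_relI[of _ _ _ _ "u \<otimes> w \<otimes> w'" "v \<otimes> w \<otimes> w'"]) (simp_all add: B'_simps)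
  next
    assume "((a, n), (a', n')) \<in> Ore_rel B' T"
    then obtain u v where uv: "u \<in> B" "v \<in> B" "a \<otimes> u = a' \<otimes> v" "n \<otimes> u = n' \<otimes> v" "n \<otimes> u \<in> T"
      by (rule B'.Ore_relE) (simp add: B'_simps)
    \<comment> \<open>\<open>n \<otimes> u\<close> is only known to lie in \<open>T\<close>;
      \<open>common\<close> moves it into \<open>S\<close> as well.\<close>
    obtain w where w: "w \<in> B" "n \<otimes> u \<otimes> w \<in> N"
      using common[OF uv(5)] by (auto simp: N_def)
    have cl: "a \<in> carrier R" "a' \<in> carrier R" "n \<in> carrier R" "n' \<in> carrier R"
      "w \<in> carrier R" "u \<in> carrier R" "v \<in> carrier R"
      using that w(1) uv(1,2) BR N by auto
    show "((a, n), (a', n')) \<in> Ore_rel R S"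
      using cl that N(1) uv w(2)
      by (intro R.Ore_relI[of _ _ _ _ "u \<otimes> w" "v \<otimes> w"]) (simp_all add: R.m_assoc[symmetric])
  qed

  have rep_R: "\<exists>a n. a \<in> B \<and> n \<in> N \<and> X = Ore_frac R S a n"
    if X: "X \<in> carrier (right_localization R S)" for X
  proof -
    obtain r s where rs: "r \<in> carrier R" "s \<in> S" "X = Ore_frac R S r s"
      using X by (rule right_localization_carrierE)
    obtain b where b: "b \<in> B" "r \<otimes> b \<in> B" "s \<otimes> b \<in> N"
      using clear[OF rs(1,2)] by (auto simp: N_def)
    have "X = Ore_frac R S (r \<otimes> b) (s \<otimes> b)"
      using rs b BR N(1) by (simp add: R.Ore_frac_reduce)
    then show ?thesis using b by blast
  qed
  have rep_B: "\<exists>a n. a \<in> B \<and> n \<in> N \<and> Y = Ore_frac B' T a n"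
    if Y: "Y \<in> carrier (right_localization B' T)" for Y
  proof -
    obtain a t where at: "a \<in> B" "t \<in> T" "Y = Ore_frac B' T a t"
      using Y by (rule right_localization_carrierE) (simp add: B'_simps)
    obtain b where b: "b \<in> B" "t \<otimes> b \<in> N"
      using common[OF at(2)] by (auto simp: N_def)
    have "Y = Ore_frac B' T (a \<otimes> b) (t \<otimes> b)"
      using at b N(2) B'.Ore_frac_reduce[of a t b] by (simp add: B'_simps)
    then show ?thesis using at b Bs(6) by blast
  qed
  \<comment> \<open>With cofactors taken from \<open>N\<close> and \<open>B\<close>, a sum or
    product is computed by the same formula in both localizations.\<close>
  have Ore_N: "\<exists>t\<in>N. \<exists>q\<in>B. a \<otimes> t = n \<otimes> q" if an: "a \<in> B" "n \<in> N" for a n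
  proof -
    obtain t q where tq: "t \<in> T" "q \<in> B" "a \<otimes> t = n \<otimes> q"
      using B'.Ore[of a n] an N(2) by (auto simp: B'_simps)
    obtain b where b: "b \<in> B" "t \<otimes> b \<in> N"
      using common[OF tq(1)] by (auto simp: N_def)
    have "a \<otimes> (t \<otimes> b) = n \<otimes> (q \<otimes> b)"
      using tq b an BR TB N by (simp add: R.m_assoc[symmetric])
    then show ?thesis using b tq Bs(6) by blast
  qed

  \<comment> \<open>A choice-free form of \<open>r/s \<mapsto> r/s\<close>: keep the pairs of a
    class that make sense on both sides and saturate them under the relation of the target.\<close>
  define h where "h X = Ore_rel B' T `` (X \<inter> (B \<times> N))" for X
  have h_frac: "h (Ore_frac R S a n) = Ore_frac B' T a n" if "a \<in> B" "n \<in> N" for a n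
  proof -
    have "Ore_frac R S a n \<inter> (B \<times> N) = Ore_frac B' T a n \<inter> (B \<times> N)"
      using that rel_iff by (auto simp: Ore_frac_def)
    moreover have "(a, n) \<in> Ore_frac B' T a n"
      using that N(2) by (intro B'.in_Ore_frac_self) (auto simp: B'_simps)
    moreover have "Ore_rel B' T `` {p} = Ore_frac B' T a n" if "p \<in> Ore_frac B' T a n" for p
      using equiv_class_eq[OF B'.equiv_Ore_rel, of "(a, n)" p] that by (simp add: Ore_frac_def)
    ultimately show ?thesis
      using that unfolding h_def by blast
  qed
  have in_R: "Ore_frac R S a n \<in> carrier (right_localization R S)"
    and in_B: "Ore_frac B' T a n \<in> carrier (right_localization B' T)" if "a \<in> B" "n \<in> N" for a n
    using that N BR by (auto intro!: Ore_frac_in_carrier simp: B'_simps)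
  have frac_iff: "Ore_frac R S a n = Ore_frac R S a' n' \<longleftrightarrow> Ore_frac B' T a n = Ore_frac B' T a' n'"
    if "a \<in> B" "n \<in> N" "a' \<in> B" "n' \<in> N" for a n a' n'
    using that N BR rel_iff by (subst R.Ore_frac_eq_iff B'.Ore_frac_eq_iff; simp add: B'_simps)+

  have bij: "bij_betw h (carrier (right_localization R S)) (carrier (right_localization B' T))"
  proof (rule bij_betwI')
    fix X Y assume "X \<in> carrier (right_localization R S)" "Y \<in> carrier (right_localization R S)"
    then show "h X = h Y \<longleftrightarrow> X = Y"
      using rep_R h_frac frac_iff by metis
  next
    fix X assume "X \<in> carrier (right_localization R S)"
    then show "h X \<in> carrier (right_localization B' T)"
      using rep_R h_frac in_B by metis
  next
    fix Y assume "Y \<in> carrier (right_localization B' T)"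
    then show "\<exists>X\<in>carrier (right_localization R S). Y = h X"
      using rep_B h_frac in_R by metis
  qed
  have mult: "h (X \<otimes>\<^bsub>right_localization R S\<^esub> Y) = h X \<otimes>\<^bsub>right_localization B' T\<^esub> h Y"
    and add: "h (X \<oplus>\<^bsub>right_localization R S\<^esub> Y) = h X \<oplus>\<^bsub>right_localization B' T\<^esub> h Y"
    if XY: "X \<in> carrier (right_localization R S)" "Y \<in> carrier (right_localization R S)" for X Y
  proof -
    obtain a m b n where ab: "a \<in> B" "m \<in> N" "b \<in> B" "n \<in> N"
      and X: "X = Ore_frac R S a m" and Y: "Y = Ore_frac R S b n"
      using rep_R[OF XY(1)] rep_R[OF XY(2)] by blast
    note cl = ab N TB BR Bs(6,7)
    obtain t q where tq: "t \<in> N" "q \<in> B" "b \<otimes> t = m \<otimes> q"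
      using Ore_N ab by meson
    have "Ore_mult R S X Y = Ore_frac R S (a \<otimes> q) (n \<otimes> t)"
      unfolding X Y using cl tq by (intro R.Ore_mult_frac) auto
    moreover have "Ore_mult B' T (h X) (h Y) = Ore_frac B' T (a \<otimes> q) (n \<otimes> t)"
      using B'.Ore_mult_frac[of a m b n q t] cl tq by (simp add: X Y h_frac B'_simps)
    ultimately show "h (X \<otimes>\<^bsub>right_localization R S\<^esub> Y) = h X \<otimes>\<^bsub>right_localization B' T\<^esub> h Y"
      using cl tq N_mult by (simp add: right_localization_def h_frac)
    obtain u v where uv: "u \<in> N" "v \<in> B" "m \<otimes> u = n \<otimes> v"
      using Ore_N[of m n] ab N TB by meson
    have mu: "m \<otimes> u \<in> N" using N_mult[OF ab(2) uv(1)] .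
    have "Ore_add R S X Y = Ore_frac R S (a \<otimes> u \<oplus> b \<otimes> v) (m \<otimes> u)"
      unfolding X Y using cl uv mu by (intro R.Ore_add_frac) auto
    moreover have "Ore_add B' T (h X) (h Y) = Ore_frac B' T (a \<otimes> u \<oplus> b \<otimes> v) (m \<otimes> u)"
      using B'.Ore_add_frac[of a m b n u v] cl uv N(2)[OF mu] by (simp add: X Y h_frac B'_simps)
    ultimately show "h (X \<oplus>\<^bsub>right_localization R S\<^esub> Y) = h X \<oplus>\<^bsub>right_localization B' T\<^esub> h Y"
      using cl uv mu by (simp add: right_localization_def h_frac)
  qed
  have smult: "h (c \<odot>\<^bsub>right_localization R S\<^esub> X) = c \<odot>\<^bsub>right_localization B' T\<^esub> h X"
    if XC: "X \<in> carrier (right_localization R S)" for c X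
  proof -
    obtain a m where am: "a \<in> B" "m \<in> N" and X: "X = Ore_frac R S a m"
      using rep_R[OF XC] by blast
    have "Ore_smult R S c X = Ore_frac R S (c \<odot> a) m"
      unfolding X using am BR N(1) by (intro Ore_smult_frac[OF RS smult_R assoc]) auto
    moreover have "Ore_smult B' T c (h X) = Ore_frac B' T (c \<odot> a) m"
      using Ore_smult_frac[OF B'.right_Ore_regular_axioms, of a m c] am smult_B assoc BR N(2)
      by (simp add: X h_frac B'_simps)
    ultimately show ?thesis
      using am smult_B by (simp add: right_localization_def h_frac)
  qed
  have "\<one> \<in> N"
    using B'.S_one by (simp add: N_def B'_simps)
  then have one: "h \<one>\<^bsub>right_localization R S\<^esub> = \<one>\<^bsub>right_localization B' T\<^esub>"
    using h_frac[of "\<one>" "\<one>"] Bs(3) by (simp add: right_localization_def B'_simps)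
  have "h \<in> ring_iso (right_localization R S) (right_localization B' T)"
    using bij mult add one bij_betwE[OF bij] by (auto simp: ring_iso_def ring_hom_def)
  then show ?thesis
    using smult unfolding algebra_isomorphic_def B'_def by blast
qed

section \<open>Normal form and Ore condition in the Weyl algebra\<close>

text \<open>The outer variable stands for \<partial>, with coefficients from K[x] on its left. The
  product of \<open>'k poly poly\<close> is commutative, so composition of operators needs a product
  of its own.\<close>

definition weyl_op :: "'k::field poly poly \<Rightarrow> 'k poly_op" where
  "weyl_op P q = (\<Sum>i\<le>degree P. coeff P i * (pderiv ^^ i) q)"

lemma weyl_op_altdef:
  assumes "degree P \<le> n"
  shows "weyl_op P q = (\<Sum>i\<le>n. coeff P i * (pderiv ^^ i) q)"
  unfolding weyl_op_def using assms
  by (intro sum.mono_neutral_left) (auto simp: coeff_eq_0)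

lemma weyl_op_0 [simp]: "weyl_op 0 q = 0"
  by (simp add: weyl_op_def)

lemma weyl_op_add: "weyl_op (P + Q) q = weyl_op P q + weyl_op Q q"
  using weyl_op_altdef[of P "max (degree P) (degree Q)" q]
    weyl_op_altdef[of Q "max (degree P) (degree Q)" q]
    weyl_op_altdef[of "P + Q" "max (degree P) (degree Q)" q] degree_add_le_max[of P Q]
  by (simp add: sum.distrib distrib_right)

lemma weyl_op_smult: "weyl_op (smult p P) q = p * weyl_op P q"
  using weyl_op_altdef[of "smult p P" "degree P" q]
  by (simp add: weyl_op_def sum_distrib_left mult.assoc degree_smult_le)

text \<open>Multiplication by the outer variable is composition with \<partial> on the right; this
  makes induction over \<open>pCons\<close> available.\<close>

lemma weyl_op_pCons: "weyl_op (pCons p P) q = p * q + weyl_op P (pderiv q)"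
proof -
  have "weyl_op (pCons p P) q = (\<Sum>i\<le>Suc (degree P). coeff (pCons p P) i * (pderiv ^^ i) q)"
    by (rule weyl_op_altdef) (simp add: degree_pCons_le)
  also have "\<dots> = p * q + weyl_op P (pderiv q)"
    by (simp add: sum.atMost_Suc_shift weyl_op_def funpow_swap1 del: sum.atMost_Suc)
  finally show ?thesis .
qed

lemma weyl_op_minus: "weyl_op (- P) q = - weyl_op P q"
  using weyl_op_smult[of "- 1" P q] by simp

lemma weyl_op_diff: "weyl_op (P - Q) q = weyl_op P q - weyl_op Q q"
  using weyl_op_add[of P "- Q" q] by (simp add: weyl_op_minus)

lemma weyl_op_sum: "weyl_op (sum f A) q = (\<Sum>i\<in>A. weyl_op (f i) q)"
  by (induction A rule: infinite_finite_induct) (simp_all add: weyl_op_add)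

lemma weyl_op_linear:
  "weyl_op P (p + q) = weyl_op P p + weyl_op P q"
  "weyl_op P (Polynomial.smult c q) = Polynomial.smult c (weyl_op P q)"
  by (simp add: weyl_op_def higher_pderiv_add distrib_left sum.distrib)
    (rule poly_eqI, simp add: weyl_op_def higher_pderiv_smult coeff_sum sum_distrib_left)

lemma weyl_op_0_right [simp]: "weyl_op P 0 = 0"
  by (simp add: weyl_op_def)

text \<open>\<open>weyl_D\<close> is the Leibniz rule \<open>\<partial> (p \<partial>\<^sup>i) = p \<partial>\<^sup>i\<^sup>+\<^sup>1 + p' \<partial>\<^sup>i\<close>, so that \<open>weyl_mult\<close> is the composition of
  operators in normal form.\<close>

definition weyl_D :: "'k::field poly poly \<Rightarrow> 'k poly poly" where
  "weyl_D P = map_poly pderiv P + pCons 0 P"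

definition weyl_mult :: "'k::field poly poly \<Rightarrow> 'k poly poly \<Rightarrow> 'k poly poly" where
  "weyl_mult P Q = (\<Sum>i\<le>degree P. smult (coeff P i) ((weyl_D ^^ i) Q))"

lemma weyl_op_D: "weyl_op (weyl_D P) q = pderiv (weyl_op P q)"
proof (induction P arbitrary: q)
  case 0
  show ?case by (simp add: weyl_D_def)
next
  case (pCons p P)
  have "weyl_D (pCons p P) = pCons (pderiv p) (weyl_D P) + pCons 0 [:p:]"
    by (rule poly_eqI) (auto simp: weyl_D_def coeff_map_poly coeff_pCons split: nat.split)
  then show ?case
    by (simp add: weyl_op_add weyl_op_pCons pCons.IH pderiv_add pderiv_mult)
qed

lemma weyl_op_mult: "weyl_op (weyl_mult P Q) q = weyl_op P (weyl_op Q q)"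
proof -
  have "weyl_op ((weyl_D ^^ i) Q) q = (pderiv ^^ i) (weyl_op Q q)" for i
    by (induction i) (simp_all add: weyl_op_D)
  then show ?thesis
    by (simp add: weyl_mult_def weyl_op_def[of P] weyl_op_sum weyl_op_smult)
qed

text \<open>In \<open>weyl_D\<close> only the shift \<open>pCons 0\<close> raises the order.
  Differentiating the coefficients does not, so the coefficient at \<open>n\<close> moves up
  unchanged.\<close>

lemma higher_weyl_D_degree:
  assumes "degree Q \<le> n"
  shows "degree ((weyl_D ^^ i) Q) \<le> n + i" "coeff ((weyl_D ^^ i) Q) (n + i) = coeff Q n"
proof -
  have "degree ((weyl_D ^^ i) Q) \<le> n + i \<and> coeff ((weyl_D ^^ i) Q) (n + i) = coeff Q n"
  proof (induction i)
    case 0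
    with assms show ?case by simp
  next
    case (Suc i)
    define P where "P = (weyl_D ^^ i) Q"
    have P: "degree P \<le> n + i" "coeff P (n + i) = coeff Q n"
      using Suc by (simp_all add: P_def)
    have *: "coeff (weyl_D P) j = pderiv (coeff P j) + (case j of 0 \<Rightarrow> 0 | Suc j \<Rightarrow> coeff P j)" for j
      by (simp add: weyl_D_def coeff_map_poly coeff_pCons)
    have "degree (weyl_D P) \<le> Suc (n + i)"
      by (rule degree_le) (use P(1) in \<open>auto simp: * coeff_eq_0 split: nat.split\<close>)
    with P show ?case by (simp add: P_def[symmetric] * coeff_eq_0)
  qed
  then show "degree ((weyl_D ^^ i) Q) \<le> n + i" "coeff ((weyl_D ^^ i) Q) (n + i) = coeff Q n"
    by auto
qed

text \<open>Commutators with \<partial> only contribute terms of lower order, so leading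
  coefficients multiply as in a commutative ring. Hence A_1 has no zero divisors.\<close>

lemma weyl_mult_degree:
  shows "degree (weyl_mult P Q) \<le> degree P + degree Q"
    and "coeff (weyl_mult P Q) (degree P + degree Q) = lead_coeff P * lead_coeff Q"
proof -
  have deg: "degree ((weyl_D ^^ i) Q) \<le> degree Q + i" for i
    by (rule higher_weyl_D_degree) simp
  show "degree (weyl_mult P Q) \<le> degree P + degree Q"
    unfolding weyl_mult_def
  proof (rule degree_sum_le)
    fix i assume "i \<in> {..degree P}"
    then show "degree (smult (coeff P i) ((weyl_D ^^ i) Q)) \<le> degree P + degree Q"
      using deg[of i] degree_smult_le[of "coeff P i" "(weyl_D ^^ i) Q"] by simp
  qed simp
  have "coeff (weyl_mult P Q) (degree P + degree Q)
      = (\<Sum>i\<le>degree P. coeff P i * coeff ((weyl_D ^^ i) Q) (degree P + degree Q))"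
    by (simp add: weyl_mult_def coeff_sum)
  also have "\<dots> = (\<Sum>i\<in>{degree P}. coeff P i * coeff ((weyl_D ^^ i) Q) (degree P + degree Q))"
    using deg by (intro sum.mono_neutral_right) (auto intro!: coeff_eq_0 le_less_trans[OF deg])
  also have "\<dots> = lead_coeff P * lead_coeff Q"
    using higher_weyl_D_degree(2)[of Q "degree Q" "degree P"] by (simp add: add.commute)
  finally show "coeff (weyl_mult P Q) (degree P + degree Q) = lead_coeff P * lead_coeff Q" .
qed

lemma weyl_mult_nonzero: "P \<noteq> 0 \<Longrightarrow> Q \<noteq> 0 \<Longrightarrow> weyl_mult P Q \<noteq> 0"
  using weyl_mult_degree(2)[of P Q] by auto

section \<open>Action of a nonzero operator on polynomials of large degree\<close>

lemma coeff_mult_degree_le: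
  fixes p q :: "'a::comm_semiring_0 poly"
  assumes "degree p \<le> a" "degree q \<le> b"
  shows "coeff (p * q) (a + b) = coeff p a * coeff q b"
proof (cases "degree p = a \<and> degree q = b")
  case True
  then show ?thesis using coeff_mult_degree_sum[of p q] by auto
next
  case False
  then have "degree p < a \<or> degree q < b" using assms by auto
  moreover from this have "degree (p * q) < a + b"
    using degree_mult_le[of p q] assms by auto
  ultimately show ?thesis
    by (auto simp: coeff_eq_0)
qed

text \<open>The product is the falling factorial of \<open>k\<close>. With subtraction taken in the
  field it is the value at \<open>k\<close> of a polynomial that depends only on
  \<open>i\<close>.\<close>

lemma coeff_higher_pderiv_degree:
  fixes q :: "'k::field poly"
  assumes "i \<le> k"
  shows "coeff ((pderiv ^^ i) q) (k - i) = (\<Prod>j<i. of_nat k - of_nat j) * coeff q k"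
  using assms
proof (induction i)
  case (Suc i)
  then have "Suc (k - Suc i) = k - i" by simp
  with Suc show ?case
    by (simp add: coeff_pderiv of_nat_diff mult_ac)
qed simp

text \<open>The terms \<open>x\<^sup>j \<partial>\<^sup>i\<close> of \<open>P\<close> for which \<open>j - i\<close> is maximal map \<open>x\<^sup>k\<close> to \<open>g(k) x\<^sup>k\<^sup>+\<^sup>j\<^sup>-\<^sup>i\<close> with a nonzero
  polynomial \<open>g\<close>, which has no large natural number as a root.\<close>

lemma weyl_op_nonzero_high_degree:
  fixes P :: "'k::field_char_0 poly poly"
  assumes "P \<noteq> 0"
  obtains N where "\<And>q. q \<noteq> 0 \<Longrightarrow> degree q \<ge> N \<Longrightarrow> weyl_op P q \<noteq> 0"
proof -
  define n where "n = degree P"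
  define I where "I = {i. coeff P i \<noteq> 0}"
  have I: "finite I" "n \<in> I" "i \<in> I \<Longrightarrow> i \<le> n" for i
    using assms le_degree by (auto simp: I_def n_def intro: finite_subset[of _ "{..degree P}"])
  \<comment> \<open>The weight j - i of the top term of the i-th coefficient, shifted by
    \<open>n\<close> so that it is a natural number.\<close>
  define w where "w i = degree (coeff P i) + n - i" for i
  define M where "M = Max (w ` I)"
  have w_le: "w i \<le> M" if "i \<in> I" for i
    using that I(1) by (simp add: M_def)
  have "M \<in> w ` I"
    unfolding M_def using I by (intro Max_in) auto
  then obtain m where m: "m \<in> I" "w m = M" by auto
  \<comment> \<open>The coefficient of weight \<open>M\<close> at order \<open>i\<close>. For
    \<open>i \<in> I\<close> the bound \<open>w i \<le> M\<close> excludes truncation in the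
    subtraction; for other \<open>i\<close> the coefficient is 0 anyway.\<close>
  define c where "c i = coeff (coeff P i) (M + i - n)" for i
  have c_zero: "c i = 0" if "i \<notin> I" for i
    using that by (simp add: c_def I_def)
  have "M + m - n = degree (coeff P m)"
    using I(3)[OF m(1)] m(2) by (simp add: w_def)
  then have "c m \<noteq> 0"
    using m(1) by (simp add: c_def I_def)
  define ff :: "nat \<Rightarrow> 'k poly" where "ff i = (\<Prod>j<i. [:- of_nat j, 1:])" for i
  define g where "g = (\<Sum>i\<le>n. Polynomial.smult (c i) (ff i))"
  have poly_ff: "poly (ff i) (of_nat k) = (\<Prod>j<i. of_nat k - of_nat j)" for i k
    by (simp add: ff_def poly_prod)
  \<comment> \<open>At the point \<open>l\<close> the falling factorials with \<open>i > l\<close>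
    vanish, and \<open>c i = 0\<close> for \<open>i < l\<close>. Only the term of \<open>l\<close>
    survives, which shows \<open>g \<noteq> 0\<close>.\<close>
  define l where "l = (LEAST i. c i \<noteq> 0)"
  have "c l \<noteq> 0" and c_below: "i < l \<Longrightarrow> c i = 0" for i
    unfolding l_def using LeastI[of "\<lambda>i. c i \<noteq> 0", OF \<open>c m \<noteq> 0\<close>] not_less_Least by blast+
  then have "l \<le> n"
    using c_zero I(3) by blast
  have "poly g (of_nat l) = (\<Sum>i\<le>n. c i * (\<Prod>j<i. of_nat l - of_nat j))"
    by (simp add: g_def poly_sum poly_ff)
  also have "\<dots> = (\<Sum>i\<in>{l}. c i * (\<Prod>j<i. of_nat l - of_nat j))"
  proof (rule sum.mono_neutral_right)
    show "\<forall>i\<in>{..n} - {l}. c i * (\<Prod>j<i. of_nat l - of_nat j) = 0"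
    proof
      fix i assume "i \<in> {..n} - {l}"
      then consider "i < l" | "l < i" by fastforce
      then show "c i * (\<Prod>j<i. of_nat l - of_nat j) = 0"
        using c_below by cases (auto intro!: prod_zero)
    qed
  qed (use \<open>l \<le> n\<close> in auto)
  also have "\<dots> \<noteq> 0"
    using \<open>c l \<noteq> 0\<close> by simp
  finally have "g \<noteq> 0" by auto
  then have "finite ((of_nat :: nat \<Rightarrow> 'k) -` {z. poly g z = 0})"
    by (intro finite_vimageI poly_roots_finite) (auto simp: inj_def)
  then obtain N0 where N0: "\<And>k. poly g (of_nat k :: 'k) = 0 \<Longrightarrow> k < N0"
    unfolding finite_nat_set_iff_bounded by auto
  show thesis
  proof
    \<comment> \<open>\<open>N0\<close> lies beyond the natural roots of \<open>g\<close>;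
      \<open>n\<close> ensures \<open>i \<le> k\<close>, so that \<open>k - i\<close> does not
      truncate for any order \<open>i\<close> that occurs.\<close>
    fix q :: "'k poly" assume q: "q \<noteq> 0" "degree q \<ge> max N0 n"
    define k where "k = degree q"
    have "coeff (coeff P i * (pderiv ^^ i) q) (M + k - n)
        = c i * (\<Prod>j<i. of_nat k - of_nat j) * lead_coeff q" if "i \<le> n" for i
    proof (cases "i \<in> I")
      case True
      have "degree (coeff P i) \<le> M + i - n" "degree ((pderiv ^^ i) q) \<le> k - i"
        using w_le[OF True] that by (auto simp: w_def k_def degree_higher_pderiv)
      then have "coeff (coeff P i * (pderiv ^^ i) q) ((M + i - n) + (k - i))
          = c i * coeff ((pderiv ^^ i) q) (k - i)"
        unfolding c_def by (rule coeff_mult_degree_le)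
      moreover have "(M + i - n) + (k - i) = M + k - n" "i \<le> k"
        using w_le[OF True] that q(2) by (auto simp: w_def k_def)
      ultimately show ?thesis
        using coeff_higher_pderiv_degree[of i k q] by (simp add: k_def)
    next
      case False
      then show ?thesis by (simp add: c_zero) (simp add: I_def)
    qed
    then have "coeff (weyl_op P q) (M + k - n) = poly g (of_nat k) * lead_coeff q"
      by (simp add: weyl_op_def n_def coeff_sum g_def poly_sum poly_ff sum_distrib_right)
    moreover have "poly g (of_nat k) \<noteq> 0"
      using N0[of k] q(2) by (auto simp: k_def)
    ultimately show "weyl_op P q \<noteq> 0"
      using q(1) by auto
  qed
qed

text \<open>Uniqueness of the normal form: a nonzero \<open>P\<close> is detected on a monomial of
  large degree. Statements about operators of A_1 thereby become statements about
  \<open>P\<close>.\<close>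

lemma weyl_op_eq_0_iff:
  fixes P :: "'k::field_char_0 poly poly"
  shows "weyl_op P = (\<lambda>q. 0) \<longleftrightarrow> P = 0"
proof
  assume 0: "weyl_op P = (\<lambda>q. 0)"
  show "P = 0"
  proof (rule ccontr)
    assume "P \<noteq> 0"
    then obtain N where "\<And>q. q \<noteq> 0 \<Longrightarrow> degree q \<ge> N \<Longrightarrow> weyl_op P q \<noteq> 0"
      using weyl_op_nonzero_high_degree by blast
    from this[of "monom 1 N"] 0 show False by (simp add: degree_monom_eq)
  qed
qed auto

section \<open>Injective right multiples and common right multiples\<close>

lemma weyl_op_comp: "weyl_op P \<circ> weyl_op Q = weyl_op (weyl_mult P Q)"
  by (auto simp: weyl_op_mult)

lemma weyl_op_right_multiple_inj:
  fixes P :: "'k::field_char_0 poly poly"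
  assumes "P \<noteq> 0"
  obtains U where "U \<noteq> 0" "inj (weyl_op P \<circ> weyl_op U)"
proof -
  obtain N where N: "\<And>q. q \<noteq> 0 \<Longrightarrow> degree q \<ge> N \<Longrightarrow> weyl_op P q \<noteq> 0"
    using assms weyl_op_nonzero_high_degree by blast
  define U :: "'k poly poly" where "U = [:monom 1 N:]"
  have U: "weyl_op U q = monom 1 N * q" for q
    by (simp add: U_def weyl_op_pCons)
  have "p = q" if "weyl_op P (weyl_op U p) = weyl_op P (weyl_op U q)" for p q
  proof (rule ccontr)
    assume "p \<noteq> q"
    then have "weyl_op P (monom 1 N * (p - q)) \<noteq> 0"
      by (intro N) (simp_all add: degree_mult_eq degree_monom_eq)
    moreover have "weyl_op P (monom 1 N * (p - q))
        = weyl_op P (monom 1 N * p) - weyl_op P (monom 1 N * q)"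
      using weyl_op_linear(1)[of P "monom 1 N * (p - q)" "monom 1 N * q"]
      by (simp add: algebra_simps)
    ultimately show False using that by (simp add: U)
  qed
  then have "inj (weyl_op P \<circ> weyl_op U)" by (auto intro: injI)
  then show thesis using that[of U] by (simp add: U_def)
qed

text \<open>Pseudo-division: if \<open>m \<ge> n\<close> are the orders of \<open>P\<close> and \<open>Q\<close>, with leading coefficients \<open>p\<close> and \<open>q\<close>,
  then \<open>P q - Q p \<partial>\<^sup>m\<^sup>-\<^sup>n\<close> has order less than \<open>m\<close>.\<close>

lemma weyl_op_common_multiple:
  fixes P Q :: "'k::field_char_0 poly poly"
  assumes "P \<noteq> 0" "Q \<noteq> 0"
  shows "\<exists>U V. U \<noteq> 0 \<and> V \<noteq> 0 \<and> weyl_op P \<circ> weyl_op U = weyl_op Q \<circ> weyl_op V"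
  using assms
proof (induction "degree P + degree Q" arbitrary: P Q rule: less_induct)
  case less
  \<comment> \<open>Stated for arbitrary \<open>P\<close> and \<open>Q\<close>, since it is applied
    with the roles exchanged when \<open>Q\<close> has the larger order.\<close>
  have step: "\<exists>U V. U \<noteq> 0 \<and> V \<noteq> 0 \<and> weyl_op P \<circ> weyl_op U = weyl_op Q \<circ> weyl_op V"
    if PQ: "P \<noteq> 0" "Q \<noteq> 0" and le: "degree Q \<le> degree P"
      and IH: "\<And>E. E \<noteq> 0 \<Longrightarrow> degree E < degree P \<Longrightarrow>
        \<exists>U V. U \<noteq> 0 \<and> V \<noteq> 0 \<and> weyl_op E \<circ> weyl_op U = weyl_op Q \<circ> weyl_op V"
    for P Q :: "'k poly poly"
  proof -
    define U0 where "U0 = [:lead_coeff Q:]"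
    define V0 where "V0 = monom (lead_coeff P) (degree P - degree Q)"
    have nz: "U0 \<noteq> 0" "V0 \<noteq> 0"
      using PQ by (simp_all add: U0_def V0_def)
    have deg: "degree P + degree U0 = degree P" "degree Q + degree V0 = degree P"
      using PQ le by (simp_all add: U0_def V0_def degree_monom_eq)
    have lead: "lead_coeff U0 = lead_coeff Q" "lead_coeff V0 = lead_coeff P"
      using PQ by (simp_all add: U0_def V0_def degree_monom_eq)
    define E where "E = weyl_mult P U0 - weyl_mult Q V0"
    have E_op: "weyl_op P (weyl_op U0 q) = weyl_op E q + weyl_op Q (weyl_op V0 q)" for q
      by (simp add: E_def weyl_op_diff weyl_op_mult)
    show ?thesis
    proof (cases "E = 0")
      case True
      then have "weyl_op P \<circ> weyl_op U0 = weyl_op Q \<circ> weyl_op V0"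
        by (auto simp: E_op)
      with nz show ?thesis by blast
    next
      case False
      have "degree E \<le> degree P"
        unfolding E_def using weyl_mult_degree(1)[of P U0] weyl_mult_degree(1)[of Q V0] deg
        by (intro degree_diff_le) auto
      moreover have "coeff E (degree P) = 0"
        using weyl_mult_degree(2)[of P U0] weyl_mult_degree(2)[of Q V0]
        unfolding deg lead by (simp add: E_def mult.commute)
      ultimately have "degree E < degree P"
        using False by (metis le_neq_implies_less leading_coeff_0_iff)
      then obtain U' V' where UV': "U' \<noteq> 0" "weyl_op E \<circ> weyl_op U' = weyl_op Q \<circ> weyl_op V'"
        using IH[OF False] by blast
      define U where "U = weyl_mult U0 U'"
      \<comment> \<open>From P U0 = E + Q V0 and E U' = Q V' one gets P U0 U' = Q (V' + V0
        U').\<close>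
      define V where "V = V' + weyl_mult V0 U'"
      have UV: "weyl_op P \<circ> weyl_op U = weyl_op Q \<circ> weyl_op V"
        using UV'(2)
        by (simp add: fun_eq_iff U_def V_def weyl_op_mult weyl_op_add weyl_op_linear E_op)
      have "U \<noteq> 0"
        using nz(1) UV'(1) by (simp add: U_def weyl_mult_nonzero)
      moreover have "V \<noteq> 0"
      proof
        assume "V = 0"
        then have "weyl_op (weyl_mult P U) = (\<lambda>q. 0)"
          using UV by (simp add: fun_eq_iff weyl_op_mult)
        with PQ(1) \<open>U \<noteq> 0\<close> show False
          by (simp add: weyl_op_eq_0_iff weyl_mult_nonzero)
      qed
      ultimately show ?thesis using UV by blast
    qed
  qed
  show ?case
  proof (cases "degree Q \<le> degree P")
    case True
    show ?thesis
      by (rule step[OF less.prems True]) (use less in auto)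
  next
    case False
    have "\<exists>V U. V \<noteq> 0 \<and> U \<noteq> 0 \<and> weyl_op Q \<circ> weyl_op V = weyl_op P \<circ> weyl_op U"
    proof (rule step[OF less.prems(2,1)])
      fix E :: "'k poly poly" assume "E \<noteq> 0" "degree E < degree Q"
      then show "\<exists>U V. U \<noteq> 0 \<and> V \<noteq> 0 \<and> weyl_op E \<circ> weyl_op U = weyl_op P \<circ> weyl_op V"
        using less.prems by (intro less.hyps) auto
    qed (use False in simp)
    then show ?thesis by metis
  qed
qed

section \<open>Denominators for the Jacobian algebra\<close>

lemma End_poly_simps [simp]:
  "f \<otimes>\<^bsub>End_poly\<^esub> g = f \<circ> g" "\<one>\<^bsub>End_poly\<^esub> = id" "\<zero>\<^bsub>End_poly\<^esub> = (\<lambda>p. 0)"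
  "f \<oplus>\<^bsub>End_poly\<^esub> g = (\<lambda>p. f p + g p)" "c \<odot>\<^bsub>End_poly\<^esub> f = (\<lambda>p. Polynomial.smult c (f p))"
  by (simp_all add: End_poly_def)

lemma End_poly_iff:
  "f \<in> carrier End_poly \<longleftrightarrow>
    (\<forall>p q. f (p + q) = f p + f q) \<and> (\<forall>c p. f (Polynomial.smult c p) = Polynomial.smult c (f p))"
proof -
  have "vector_space (Polynomial.smult :: 'a \<Rightarrow> 'a poly \<Rightarrow> 'a poly)"
    by unfold_locales (simp_all add: smult_add_right smult_add_left)
  then show ?thesis
    by (simp add: End_poly_def Vector_Spaces.linear_iff)
qed

lemma ring_End_poly: "ring (End_poly :: ('k::field, 'k poly_op) module)"
proof (rule ringI)
  show "abelian_group (End_poly :: ('k, 'k poly_op) module)"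
  proof (rule abelian_groupI)
    fix f :: "'k poly_op" assume "f \<in> carrier End_poly"
    then show "\<exists>g\<in>carrier End_poly. g \<oplus>\<^bsub>End_poly\<^esub> f = \<zero>\<^bsub>End_poly\<^esub>"
      by (intro bexI[of _ "\<lambda>p. - f p"]) (simp_all add: End_poly_iff)
  qed (auto simp: End_poly_iff smult_add_right fun_eq_iff)
  show "monoid (End_poly :: ('k, 'k poly_op) module)"
    by (rule monoidI) (auto simp: End_poly_iff)
qed (auto simp: End_poly_iff fun_eq_iff)

lemma End_poly_uminus:
  assumes "f \<in> carrier End_poly"
  shows "\<ominus>\<^bsub>End_poly\<^esub> f = (\<lambda>p. - f p)"
proof -
  interpret ring "End_poly :: ('a, 'a poly_op) module" by (rule ring_End_poly)
  have "(\<lambda>p. - f p) \<in> carrier End_poly"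
    using assms by (simp add: End_poly_iff)
  then show ?thesis
    using minus_equality[of "\<lambda>p. - f p" f] assms by simp
qed

lemma unital_subalgebra_End_polyI:
  assumes "B \<subseteq> carrier End_poly" "id \<in> B"
    and "\<And>f g. f \<in> B \<Longrightarrow> g \<in> B \<Longrightarrow> f \<circ> g \<in> B"
    and "\<And>f g. f \<in> B \<Longrightarrow> g \<in> B \<Longrightarrow> (\<lambda>p. f p + g p) \<in> B"
    and smult: "\<And>c f. f \<in> B \<Longrightarrow> (\<lambda>p. Polynomial.smult c (f p)) \<in> B"
  shows "unital_subalgebra End_poly B"
proof -
  interpret ring "End_poly :: ('a, 'a poly_op) module" by (rule ring_End_poly)
  have "subring B End_poly"
  proof (rule subringI)
    fix f assume "f \<in> B"
    then show "\<ominus>\<^bsub>End_poly\<^esub> f \<in> B"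
      using smult[of f "- 1"] assms(1) by (subst End_poly_uminus) auto
  qed (use assms in auto)
  then show ?thesis
    using smult by (simp add: unital_subalgebra_def)
qed

lemma unital_subalgebra_End_polyE:
  assumes "unital_subalgebra End_poly B"
  shows "B \<subseteq> carrier End_poly" "id \<in> B" "(\<lambda>p. 0) \<in> B"
    and "\<And>f g. f \<in> B \<Longrightarrow> g \<in> B \<Longrightarrow> f \<circ> g \<in> B"
    and "\<And>f g. f \<in> B \<Longrightarrow> g \<in> B \<Longrightarrow> (\<lambda>p. f p + g p) \<in> B"
    and "\<And>c f. f \<in> B \<Longrightarrow> (\<lambda>p. Polynomial.smult c (f p)) \<in> B"
  using assms subringE[of B End_poly] by (auto simp: unital_subalgebra_def)

text \<open>The hull is an intersection, and subalgebras are closed only under nonempty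
  intersections; the assumption puts the whole endomorphism algebra into the family.\<close>

lemma unital_subalgebra_hull:
  assumes "X \<subseteq> carrier End_poly"
  shows "unital_subalgebra End_poly (unital_subalgebra End_poly hull X)"
proof -
  have "unital_subalgebra End_poly (carrier End_poly)"
    by (rule unital_subalgebra_End_polyI) (auto simp: End_poly_iff smult_add_right mult.commute)
  then show ?thesis
    using assms unfolding hull_def
    by (intro unital_subalgebra_End_polyI) (blast intro: unital_subalgebra_End_polyE(2,4-6))+
qed

lemma weyl_op_End_poly: "weyl_op P \<in> carrier End_poly"
  by (simp add: End_poly_iff weyl_op_linear)

lemma weyl_op_one: "weyl_op 1 = id"
  by (rule ext) (simp add: weyl_op_def)

lemma X_op_eq_weyl_op: "X_op = weyl_op [:[:0, 1:]:]"
  by (rule ext) (simp add: weyl_op_def X_op_def)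

lemma pderiv_eq_weyl_op: "pderiv = weyl_op [:0, 1:]"
  by (rule ext) (simp add: weyl_op_def)

lemma unital_subalgebra_range_weyl_op:
  "unital_subalgebra End_poly (range (weyl_op :: _ \<Rightarrow> 'k::field poly_op))"
proof (rule unital_subalgebra_End_polyI)
  show "range weyl_op \<subseteq> carrier End_poly"
    using weyl_op_End_poly by blast
  show "id \<in> range weyl_op"
    by (metis weyl_op_one rangeI)
next
  fix f g :: "'k poly_op" and c
  assume "f \<in> range weyl_op" "g \<in> range weyl_op"
  then obtain P Q where [simp]: "f = weyl_op P" "g = weyl_op Q" by blast
  show "f \<circ> g \<in> range weyl_op"
    by (simp add: weyl_op_comp)
  have "(\<lambda>p. f p + g p) = weyl_op (P + Q)"
    by (simp add: fun_eq_iff weyl_op_add)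
  then show "(\<lambda>p. f p + g p) \<in> range weyl_op" by blast
next
  fix f :: "'k poly_op" and c
  assume "f \<in> range weyl_op"
  then obtain P where "f = weyl_op P" by blast
  then have "(\<lambda>p. Polynomial.smult c (f p)) = weyl_op (smult [:c:] P)"
    by (simp add: fun_eq_iff weyl_op_smult)
  then show "(\<lambda>p. Polynomial.smult c (f p)) \<in> range weyl_op" by blast
qed

lemma weyl_op_in_subalgebra:
  assumes B: "unital_subalgebra End_poly B" and X: "X_op \<in> B" and D: "pderiv \<in> B"
  shows "weyl_op P \<in> B"
proof (induction P)
  case 0
  show ?case using unital_subalgebra_End_polyE(3)[OF B] by (simp add: weyl_op_def[abs_def])
next
  case (pCons p P)
  have p: "(*) p \<in> B"
  proof (induction p)
    case 0
    show ?case using unital_subalgebra_End_polyE(3)[OF B] by simp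
  next
    case (pCons c p)
    have "(*) (pCons c p) = (\<lambda>q. Polynomial.smult c (id q) + (X_op \<circ> (*) p) q)"
      by (simp add: fun_eq_iff X_op_def)
    then show ?case
      using unital_subalgebra_End_polyE(2,4-6)[OF B] X pCons.IH by metis
  qed
  have "weyl_op (pCons p P) = (\<lambda>q. p * q + (weyl_op P \<circ> pderiv) q)"
    by (simp add: fun_eq_iff weyl_op_pCons)
  then show ?case
    using unital_subalgebra_End_polyE(4,5)[OF B] D p pCons.IH by metis
qed

text \<open>\<open>weyl_mult\<close> shows that normal forms are closed under composition, so they
  already exhaust the generated subalgebra.\<close>

lemma Weyl_algebra_eq:
  "Weyl_algebra = (End_poly :: ('k::field, 'k poly_op) module)\<lparr>carrier := range weyl_op\<rparr>"
proof -
  have "unital_subalgebra End_poly hull {X_op, pderiv} = range (weyl_op :: _ \<Rightarrow> 'k poly_op)"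
  proof (rule hull_unique)
    show "{X_op, pderiv} \<subseteq> range weyl_op"
      using X_op_eq_weyl_op pderiv_eq_weyl_op by blast
  qed (use unital_subalgebra_range_weyl_op weyl_op_in_subalgebra in \<open>auto simp: image_subset_iff\<close>)
  then show ?thesis
    by (simp add: Weyl_algebra_def generated_subalgebra_def)
qed

section \<open>The inverse of H and the Jacobian algebra\<close>

lemma H_op_linear:
  "H_op (p + q) = H_op p + H_op q"
  "H_op (Polynomial.smult c p) = Polynomial.smult c (H_op p)"
  by (simp_all add: H_op_def X_op_def pderiv_add pderiv_smult pderiv_pCons smult_add_right)

lemma coeff_H_op: "coeff (H_op p) n = of_nat (Suc n) * coeff p n"
  by (simp add: H_op_def X_op_def coeff_pderiv)

text \<open>On coefficients H is diagonal with entries n + 1, which are invertible in characteristic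
  zero.\<close>

lemma bij_H_op: "bij (H_op :: 'k::field_char_0 poly_op)"
proof (rule bijI)
  show "inj (H_op :: 'k poly_op)"
  proof (rule injI)
    fix p q :: "'k poly" assume "H_op p = H_op q"
    then have "coeff (H_op p) n = coeff (H_op q) n" for n by simp
    then show "p = q"
      unfolding coeff_H_op poly_eq_iff by (metis mult_cancel_left of_nat_eq_0_iff nat.distinct(1))
  qed
  show "surj (H_op :: 'k poly_op)"
  proof (rule surjI)
    fix p :: "'k poly"
    define q where "q = Abs_poly (\<lambda>n. coeff p n / of_nat (Suc n))"
    have "coeff q n = coeff p n / of_nat (Suc n)" for n
      unfolding q_def
      by (subst coeff_Abs_poly[of "degree p"]) (auto simp: coeff_eq_0)
    then show "H_op (Abs_poly (\<lambda>n. coeff p n / of_nat (Suc n))) = p"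
      unfolding q_def[symmetric] by (intro poly_eqI) (simp add: coeff_H_op del: of_nat_Suc)
  qed
qed

lemma H_inverse:
  fixes p :: "'k::field_char_0 poly"
  shows "inv_into UNIV H_op (H_op p) = p" "H_op (inv_into UNIV H_op p) = p"
  by (simp_all add: bij_H_op bij_is_inj bij_is_surj surj_f_inv_f)

lemma inv_H_op_End_poly: "(inv_into UNIV H_op :: 'k::field_char_0 poly_op) \<in> carrier End_poly"
  unfolding End_poly_iff
proof (intro conjI allI)
  fix p q :: "'k poly" and c
  show "inv_into UNIV H_op (p + q) = inv_into UNIV H_op p + inv_into UNIV H_op q"
    by (metis H_inverse H_op_linear(1))
  show "inv_into UNIV H_op (Polynomial.smult c p) = Polynomial.smult c (inv_into UNIV H_op p)"
    by (metis H_inverse H_op_linear(2))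
qed

definition jacobian :: "'k::field_char_0 poly_op set" where
  "jacobian = unital_subalgebra End_poly hull (range weyl_op \<union> {inv_into UNIV H_op})"

lemma Jacobian_algebra_eq: "Jacobian_algebra = End_poly\<lparr>carrier := jacobian\<rparr>"
  by (simp add: Jacobian_algebra_def generated_subalgebra_def jacobian_def Weyl_algebra_eq)

lemma unital_subalgebra_jacobian: "unital_subalgebra End_poly jacobian"
  unfolding jacobian_def
  by (rule unital_subalgebra_hull) (use inv_H_op_End_poly weyl_op_End_poly in auto)

lemma weyl_op_in_jacobian: "weyl_op P \<in> jacobian"
  unfolding jacobian_def by (intro hull_inc) auto

text \<open>The right Ore condition of A_1 for nonzero denominators; the numerator may vanish, and
  then \<open>V = 0\<close> serves.\<close>

lemma weyl_op_common_multiple':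
  fixes P Q :: "'k::field_char_0 poly poly"
  assumes "Q \<noteq> 0"
  obtains U V where "U \<noteq> 0" "weyl_op P \<circ> weyl_op U = weyl_op Q \<circ> weyl_op V"
proof (cases "P = 0")
  case True
  then show thesis using that[of 1 0] by (simp add: fun_eq_iff)
next
  case False
  then show thesis using that assms weyl_op_common_multiple by blast
qed

text \<open>The set of all \<open>f\<close> with this property is a subalgebra by the Ore condition in the Weyl algebra,
  and it contains \<open>H\<^sup>-\<^sup>1\<close> because \<open>H\<^sup>-\<^sup>1 H = 1\<close>.\<close>

lemma jacobian_right_denominator:
  assumes "f \<in> jacobian"
  obtains U V where "U \<noteq> 0" "f \<circ> weyl_op U = weyl_op V"
proof -
  define T :: "'a poly_op set" where
    "T = {f \<in> carrier End_poly. \<exists>U V. U \<noteq> 0 \<and> f \<circ> weyl_op U = weyl_op V}"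
  have "unital_subalgebra End_poly T"
  proof (rule unital_subalgebra_End_polyI)
    show "T \<subseteq> carrier End_poly" by (auto simp: T_def)
    show "id \<in> T"
      by (auto simp: T_def End_poly_iff intro!: exI[of _ 1])
  next
    fix f g assume "f \<in> T" "g \<in> T"
    then obtain U V U' V' where f: "f \<in> carrier End_poly" "U \<noteq> 0" "f \<circ> weyl_op U = weyl_op V"
      and g: "g \<in> carrier End_poly" "U' \<noteq> 0" "g \<circ> weyl_op U' = weyl_op V'"
      by (auto simp: T_def)
    \<comment> \<open>Since g U' = V' and V' A = U B, it follows that f g U' A = f U B = V
      B.\<close>
    obtain A B where AB: "A \<noteq> 0" "weyl_op V' \<circ> weyl_op A = weyl_op U \<circ> weyl_op B"
      using f(2) by (rule weyl_op_common_multiple')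
    have "(f \<circ> g) \<circ> weyl_op (weyl_mult U' A) = f \<circ> ((g \<circ> weyl_op U') \<circ> weyl_op A)"
      by (simp add: weyl_op_comp[symmetric] comp_assoc)
    also have "\<dots> = weyl_op (weyl_mult V B)"
      unfolding g(3) AB(2) weyl_op_comp[symmetric] f(3)[symmetric] by (simp add: comp_assoc)
    finally show "f \<circ> g \<in> T"
      using f(1) g(1,2) AB(1) weyl_mult_nonzero[of U' A] by (auto simp: T_def End_poly_iff)
    \<comment> \<open>U C = U' D is a common denominator of \<open>f\<close> and \<open>g\<close>,
      over which the numerators V C and V' D can be added.\<close>
    obtain C D where CD: "C \<noteq> 0" "weyl_op U \<circ> weyl_op C = weyl_op U' \<circ> weyl_op D"
      using g(2) by (rule weyl_op_common_multiple')
    have "(\<lambda>p. f p + g p) \<circ> weyl_op (weyl_mult U C) = weyl_op (weyl_mult V C + weyl_mult V' D)"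
    proof
      fix p
      have "weyl_op U (weyl_op C p) = weyl_op U' (weyl_op D p)"
        "f (weyl_op U q) = weyl_op V q" "g (weyl_op U' q) = weyl_op V' q" for q
        using CD(2) f(3) g(3) by (simp_all add: fun_eq_iff)
      then show "((\<lambda>p. f p + g p) \<circ> weyl_op (weyl_mult U C)) p
          = weyl_op (weyl_mult V C + weyl_mult V' D) p"
        by (simp add: weyl_op_mult weyl_op_add) (metis)
    qed
    moreover have "(\<lambda>p. f p + g p) \<in> carrier End_poly"
      using f(1) g(1) by (simp add: End_poly_iff smult_add_right)
    ultimately show "(\<lambda>p. f p + g p) \<in> T"
      using weyl_mult_nonzero[OF f(2) CD(1)] by (auto simp: T_def)
  next
    fix f c assume "f \<in> T"
    then obtain U V where f: "f \<in> carrier End_poly" "U \<noteq> 0" "f \<circ> weyl_op U = weyl_op V"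
      by (auto simp: T_def)
    have "(\<lambda>p. Polynomial.smult c (f p)) \<circ> weyl_op U = weyl_op (smult [:c:] V)"
      using f(3) by (simp add: fun_eq_iff weyl_op_smult)
    moreover have "(\<lambda>p. Polynomial.smult c (f p)) \<in> carrier End_poly"
      using f(1) by (simp add: End_poly_iff smult_add_right mult.commute)
    ultimately show "(\<lambda>p. Polynomial.smult c (f p)) \<in> T"
      using f(2) by (auto simp: T_def)
  qed
  moreover have "weyl_op P \<in> T" for P :: "'a poly poly"
  proof -
    have "weyl_op P \<circ> weyl_op 1 = weyl_op P" by (simp add: weyl_op_one)
    then have "\<exists>U V. U \<noteq> 0 \<and> weyl_op P \<circ> weyl_op U = weyl_op V"
      using zero_neq_one by metis
    then show ?thesis
      by (simp add: T_def weyl_op_End_poly)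
  qed
  moreover have "inv_into UNIV H_op \<in> T"
  proof -
    \<comment> \<open>The normal form of H = \<partial> x.\<close>
    define W :: "'a poly poly" where "W = weyl_mult [:0, 1:] [:[:0, 1:]:]"
    have "W \<noteq> 0" by (simp add: W_def weyl_mult_nonzero)
    moreover have "inv_into UNIV H_op \<circ> weyl_op W = weyl_op 1"
      unfolding W_def weyl_op_comp[symmetric] X_op_eq_weyl_op[symmetric] pderiv_eq_weyl_op[symmetric]
        H_op_def[symmetric] weyl_op_one
      by (simp add: fun_eq_iff H_inverse)
    ultimately show ?thesis
      using inv_H_op_End_poly by (auto simp: T_def)
  qed
  ultimately have "jacobian \<subseteq> T"
    unfolding jacobian_def by (intro hull_minimal) auto
  with assms that show thesis by (auto simp: T_def)
qed

text \<open>The second denominator is chosen for g U, again an element of J, rather than for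
  \<open>g\<close>; then U U' serves both operators.\<close>

lemma jacobian_right_denominator2:
  assumes "f \<in> jacobian" "g \<in> jacobian"
  obtains U A B where "U \<noteq> 0" "f \<circ> weyl_op U = weyl_op A" "g \<circ> weyl_op U = weyl_op B"
proof -
  obtain U V where U: "U \<noteq> 0" "f \<circ> weyl_op U = weyl_op V"
    using assms(1) by (rule jacobian_right_denominator)
  have "g \<circ> weyl_op U \<in> jacobian"
    using assms(2) weyl_op_in_jacobian unital_subalgebra_End_polyE(4)[OF unital_subalgebra_jacobian]
    by blast
  then obtain U' V' where U': "U' \<noteq> 0" "g \<circ> weyl_op U \<circ> weyl_op U' = weyl_op V'"
    by (rule jacobian_right_denominator)
  have "f \<circ> weyl_op (weyl_mult U U') = weyl_op (weyl_mult V U')"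
    unfolding weyl_op_comp[symmetric] U(2)[symmetric] by (simp add: comp_assoc)
  moreover have "g \<circ> weyl_op (weyl_mult U U') = weyl_op V'"
    using U'(2) by (simp add: weyl_op_comp[symmetric] comp_assoc)
  ultimately show thesis
    using that weyl_mult_nonzero[OF U(1) U'(1)] by blast
qed

section \<open>Right regular elements of the Jacobian algebra\<close>

lemma right_regular_Jacobian_iff:
  "c \<in> right_regular Jacobian_algebra \<longleftrightarrow>
    c \<in> jacobian \<and> (\<forall>r\<in>jacobian. c \<circ> r = (\<lambda>p. 0) \<longrightarrow> r = (\<lambda>p. 0))"
  by (simp add: right_regular_def Jacobian_algebra_eq)

lemma inj_imp_right_regular_Jacobian:
  assumes "inj c" "c \<in> jacobian"
  shows "c \<in> right_regular Jacobian_algebra"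
  unfolding right_regular_Jacobian_iff
proof (intro conjI ballI impI ext)
  have "c \<in> carrier End_poly"
    using assms(2) unital_subalgebra_End_polyE(1)[OF unital_subalgebra_jacobian] by blast
  then have "c (Polynomial.smult 0 0) = Polynomial.smult 0 (c 0)"
    unfolding End_poly_iff by blast
  then have c0: "c 0 = 0" by simp
  fix r p assume "c \<circ> r = (\<lambda>p. 0)"
  then have "c (r p) = c 0" by (simp add: fun_eq_iff c0)
  with assms(1) show "r p = 0" by (simp add: inj_eq)
qed (use assms in simp)

text \<open>If \<open>B\<close> were 0, right regularity of \<open>s\<close> would force U = 0. A
  nonzero \<open>B\<close> is what the Ore condition of A_1 asks of a denominator.\<close>

lemma right_regular_clear:
  assumes r: "r \<in> jacobian" and s: "s \<in> right_regular Jacobian_algebra"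
  obtains U A B where "U \<noteq> 0" "B \<noteq> 0" "r \<circ> weyl_op U = weyl_op A" "s \<circ> weyl_op U = weyl_op B"
proof -
  have sJ: "s \<in> jacobian" using s by (simp add: right_regular_Jacobian_iff)
  obtain U A B where U: "U \<noteq> 0" "r \<circ> weyl_op U = weyl_op A" "s \<circ> weyl_op U = weyl_op B"
    using r sJ by (rule jacobian_right_denominator2)
  have "B \<noteq> 0"
  proof
    assume "B = 0"
    then have "s \<circ> weyl_op U = (\<lambda>p. 0)" using U(3) by (simp add: fun_eq_iff)
    then have "weyl_op U = (\<lambda>p. 0)"
      using s weyl_op_in_jacobian by (auto simp: right_regular_Jacobian_iff)
    with U(1) show False by (simp add: weyl_op_eq_0_iff)
  qed
  with U that show thesis by blast
qed

lemma right_regular_Jacobian_mult: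
  assumes "s \<in> right_regular Jacobian_algebra" "t \<in> right_regular Jacobian_algebra"
  shows "s \<circ> t \<in> right_regular Jacobian_algebra"
  unfolding right_regular_Jacobian_iff
proof (intro conjI ballI impI)
  note J = unital_subalgebra_End_polyE(4)[OF unital_subalgebra_jacobian]
  show "s \<circ> t \<in> jacobian"
    using assms J unfolding right_regular_Jacobian_iff by blast
  fix r :: "'a poly_op" assume "r \<in> jacobian" "s \<circ> t \<circ> r = (\<lambda>p. 0)"
  then show "r = (\<lambda>p. 0)"
    using assms J by (metis comp_assoc right_regular_Jacobian_iff)
qed

text \<open>With r U = A and s U = B \<noteq> 0 in A_1, a common multiple A C = B D yields r (U C) =
  s (U D).\<close>

lemma right_Ore_regular_Jacobian:
  "right_Ore_regular (Jacobian_algebra :: ('k::field_char_0, 'k poly_op) module)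
    (right_regular Jacobian_algebra)"
proof -
  let ?J = "Jacobian_algebra :: ('k, 'k poly_op) module"
  note J = unital_subalgebra_jacobian[where 'a = 'k]
  note JE = unital_subalgebra_End_polyE[OF J]
  interpret E: ring "End_poly :: ('k, 'k poly_op) module" by (rule ring_End_poly)
  have ring: "ring ?J"
    unfolding Jacobian_algebra_eq using J by (intro E.subring_is_ring) (simp add: unital_subalgebra_def)
  have one: "id \<in> right_regular ?J"
    using JE(2) by (auto simp: right_regular_Jacobian_iff)
  have zero: "(\<lambda>p. 0) \<notin> right_regular ?J"
  proof
    assume "(\<lambda>p. 0) \<in> right_regular ?J"
    then have "id = (\<lambda>p :: 'k poly. 0 :: 'k poly)"
      using JE(2) by (auto simp: right_regular_Jacobian_iff)
    from fun_cong[OF this, of 1] show False by simp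
  qed
  have "multiplicative_set ?J (right_regular ?J)"
    unfolding multiplicative_set_def submonoid_def
  proof (intro conjI allI impI)
    show "right_regular ?J \<subseteq> carrier ?J" by (auto simp: right_regular_def)
    show "x \<otimes>\<^bsub>?J\<^esub> y \<in> right_regular ?J" if "x \<in> right_regular ?J" "y \<in> right_regular ?J" for x y
      using right_regular_Jacobian_mult[OF that] by (subst Jacobian_algebra_eq) simp
    show "\<one>\<^bsub>?J\<^esub> \<in> right_regular ?J" using one by (subst Jacobian_algebra_eq) simp
    show "\<zero>\<^bsub>?J\<^esub> \<notin> right_regular ?J" using zero by (subst Jacobian_algebra_eq) simp
  qed
  moreover have "(r <#\<^bsub>?J\<^esub> right_regular ?J) \<inter> (s <#\<^bsub>?J\<^esub> carrier ?J) \<noteq> {}"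
    if r: "r \<in> carrier ?J" and s: "s \<in> right_regular ?J" for r s
  proof -
    obtain U A B where U: "U \<noteq> 0" "B \<noteq> 0" "r \<circ> weyl_op U = weyl_op A" "s \<circ> weyl_op U = weyl_op B"
      using r s by (auto simp: Jacobian_algebra_eq elim: right_regular_clear)
    obtain C D where C: "C \<noteq> 0" "weyl_op A \<circ> weyl_op C = weyl_op B \<circ> weyl_op D"
      using U(2) by (rule weyl_op_common_multiple')
    \<comment> \<open>U C is nonzero but, like \<partial>, may fail to be right regular in J.
      Composition with W on the right makes it injective and preserves the identity.\<close>
    obtain W where W: "W \<noteq> 0" "inj (weyl_op (weyl_mult U C) \<circ> weyl_op W)"
      using weyl_mult_nonzero[OF U(1) C(1)] by (rule weyl_op_right_multiple_inj)
    define t where "t = weyl_op (weyl_mult (weyl_mult U C) W)"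
    define q where "q = weyl_op (weyl_mult (weyl_mult U D) W)"
    have "t \<in> right_regular ?J"
      using W(2) by (intro inj_imp_right_regular_Jacobian)
        (auto simp: t_def weyl_op_comp weyl_op_in_jacobian)
    moreover have "q \<in> carrier ?J"
      by (simp add: q_def weyl_op_in_jacobian Jacobian_algebra_eq)
    moreover have "r \<circ> t = s \<circ> q"
    proof -
      have "r \<circ> t = (r \<circ> weyl_op U) \<circ> weyl_op C \<circ> weyl_op W"
        by (simp add: t_def weyl_op_comp[symmetric] comp_assoc)
      also have "\<dots> = (s \<circ> weyl_op U) \<circ> weyl_op D \<circ> weyl_op W"
        unfolding U(3,4) C(2) ..
      also have "\<dots> = s \<circ> q"
        by (simp add: q_def weyl_op_comp[symmetric] comp_assoc)
      finally show ?thesis .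
    qed
    ultimately show ?thesis
      unfolding l_coset_def by (auto simp: Jacobian_algebra_eq)
  qed
  ultimately show ?thesis
    using ring unfolding right_Ore_regular_def right_Ore_regular_axioms_def right_Ore_set_def by blast
qed

text \<open>An element annihilated by a right regular one is already 0, so t = 1 satisfies the
  denominator condition.\<close>

lemma (in right_Ore_regular) right_denominator_set: "right_denominator_set R S"
  unfolding right_denominator_set_def
proof (intro conjI ballI impI bexI[of _ \<one>])
  fix r s assume "r \<in> carrier R" "s \<in> S" "s \<otimes> r = \<zero>"
  then have "r = \<zero>"
    using regular unfolding right_regular_def by blast
  then show "r \<otimes> \<one> = \<zero>" by simp
qed (simp_all add: Ore_set)

text \<open>The set of all right regular elements bounds every candidate; once it is a denominator
  set itself, it is the greatest one.\<close>

lemma largest_right_regular_denominator_set_eq: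
  assumes "right_Ore_regular R (right_regular R)"
  shows "largest_right_regular_denominator_set R = right_regular R"
  unfolding largest_right_regular_denominator_set_def
  by (rule Greatest_equality) (use right_Ore_regular.right_denominator_set[OF assms] in auto)

text \<open>A_1 is a domain, so its classical quotient ring inverts every nonzero operator.\<close>

lemma regular_Weyl_algebra:
  "regular Weyl_algebra = weyl_op ` (- {0 :: 'k::field_char_0 poly poly})"
proof -
  have *: "weyl_op P \<circ> weyl_op Q = (\<lambda>q. 0) \<longleftrightarrow> P = 0 \<or> Q = 0" for P Q :: "'k poly poly"
  proof (cases "P = 0 \<or> Q = 0")
    case True
    then show ?thesis by (auto simp: fun_eq_iff)
  next
    case False
    then show ?thesis by (simp add: weyl_op_comp weyl_op_eq_0_iff weyl_mult_nonzero)
  qed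
  have 1: "weyl_op (1 :: 'k poly poly) \<noteq> (\<lambda>q. 0)"
    by (simp add: weyl_op_eq_0_iff)
  show ?thesis
  proof (intro equalityI subsetI)
    fix c :: "'k poly_op" assume c: "c \<in> regular Weyl_algebra"
    then obtain P where P: "c = weyl_op P"
      by (auto simp: regular_def right_regular_def Weyl_algebra_eq)
    have "P \<noteq> 0"
    proof
      assume "P = 0"
      then have "c \<circ> weyl_op 1 = (\<lambda>q. 0)" by (simp add: P *)
      with c 1 show False
        by (auto simp: regular_def right_regular_def Weyl_algebra_eq)
    qed
    with P show "c \<in> weyl_op ` (- {0})" by blast
  next
    fix c :: "'k poly_op" assume "c \<in> weyl_op ` (- {0})"
    then obtain P where "c = weyl_op P" "P \<noteq> 0" by blast
    then show "c \<in> regular Weyl_algebra"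
      using * by (auto simp: regular_def right_regular_def Weyl_algebra_eq weyl_op_eq_0_iff)
  qed
qed

lemma right_Ore_regular_Weyl:
  "right_Ore_regular (Weyl_algebra :: ('k::field_char_0, 'k poly_op) module) (regular Weyl_algebra)"
proof -
  let ?A = "Weyl_algebra :: ('k, 'k poly_op) module"
  interpret E: ring "End_poly :: ('k, 'k poly_op) module" by (rule ring_End_poly)
  have ring: "ring ?A"
    unfolding Weyl_algebra_eq using unital_subalgebra_range_weyl_op[where 'k = 'k]
    by (intro E.subring_is_ring) (simp add: unital_subalgebra_def)
  have "multiplicative_set ?A (regular ?A)"
    unfolding multiplicative_set_def submonoid_def
  proof (intro conjI)
    show "regular ?A \<subseteq> carrier ?A" by (auto simp: regular_def right_regular_def)
    show "\<forall>x y. x \<in> regular ?A \<longrightarrow> y \<in> regular ?A \<longrightarrow> x \<otimes>\<^bsub>?A\<^esub> y \<in> regular ?A"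
      unfolding regular_Weyl_algebra
      by (auto simp: Weyl_algebra_eq weyl_op_comp weyl_mult_nonzero)
    have "id = weyl_op (1 :: 'k poly poly)" by (simp add: weyl_op_one)
    then show "\<one>\<^bsub>?A\<^esub> \<in> regular ?A"
      unfolding regular_Weyl_algebra by (auto simp: Weyl_algebra_eq)
    have "(\<lambda>p. 0) \<noteq> weyl_op P" if "P \<noteq> 0" for P :: "'k poly poly"
      using that weyl_op_eq_0_iff[of P] by auto
    then show "\<zero>\<^bsub>?A\<^esub> \<notin> regular ?A"
      unfolding regular_Weyl_algebra by (auto simp: Weyl_algebra_eq)
  qed
  moreover have "(r <#\<^bsub>?A\<^esub> regular ?A) \<inter> (s <#\<^bsub>?A\<^esub> carrier ?A) \<noteq> {}"
    if r: "r \<in> carrier ?A" and s: "s \<in> regular ?A" for r s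
  proof -
    obtain P Q where PQ: "r = weyl_op P" "s = weyl_op Q" "Q \<noteq> 0"
      using r s unfolding regular_Weyl_algebra by (auto simp: Weyl_algebra_eq)
    obtain U V where U: "U \<noteq> 0" "weyl_op P \<circ> weyl_op U = weyl_op Q \<circ> weyl_op V"
      using PQ(3) by (rule weyl_op_common_multiple')
    have "weyl_op U \<in> regular ?A" "weyl_op V \<in> carrier ?A"
      using U(1) unfolding regular_Weyl_algebra by (auto simp: Weyl_algebra_eq)
    then show ?thesis
      using U(2) unfolding l_coset_def PQ by (auto simp: Weyl_algebra_eq)
  qed
  moreover have "regular ?A \<subseteq> right_regular ?A"
    by (auto simp: regular_def)
  ultimately show ?thesis
    using ring unfolding right_Ore_regular_def right_Ore_regular_axioms_def right_Ore_set_def by blast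
qed

theorem corollary5p6:
  shows "algebra_isomorphic
    (right_regular_right_quotient_ring (Jacobian_algebra :: ('k::field_char_0, 'k poly_op) module))
    (classical_right_quotient_ring (Weyl_algebra :: ('k, 'k poly_op) module))"
proof -
  let ?J = "Jacobian_algebra :: ('k, 'k poly_op) module"
  let ?A = "Weyl_algebra :: ('k, 'k poly_op) module"
  have A_eq: "?A = ?J\<lparr>carrier := range weyl_op\<rparr>"
    by (simp add: Weyl_algebra_eq Jacobian_algebra_eq)
  note JE = unital_subalgebra_End_polyE[OF unital_subalgebra_jacobian[where 'a = 'k]]
  note AE = unital_subalgebra_End_polyE[OF unital_subalgebra_range_weyl_op[where 'k = 'k]]
  have J_mult: "f \<otimes>\<^bsub>?J\<^esub> g = f \<circ> g" for f g
    by (simp add: Jacobian_algebra_eq)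
  \<comment> \<open>An injective operator of A_1 is a denominator on both sides: right regular in J
    by injectivity, regular in A_1 because it is nonzero.\<close>
  have inj_common: "weyl_op P \<circ> f \<in> right_regular ?J \<inter> regular ?A"
    if "f = weyl_op U" "U \<noteq> 0" "P \<noteq> 0" "inj (weyl_op P \<circ> f)" for P U :: "'k poly poly" and f
    using that inj_imp_right_regular_Jacobian[of "weyl_op P \<circ> f"] weyl_op_in_jacobian
      weyl_mult_nonzero[of P U]
    by (auto simp: weyl_op_comp regular_Weyl_algebra)
  have "algebra_isomorphic (right_localization ?J (right_regular ?J))
    (right_localization (?J\<lparr>carrier := range weyl_op\<rparr>) (regular ?A))"
  proof (rule right_localization_subring_iso)
    show "right_Ore_regular ?J (right_regular ?J)"
      by (rule right_Ore_regular_Jacobian)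
    then interpret J: right_Ore_regular ?J "right_regular ?J" .
    show "subring (range weyl_op) ?J"
      using right_Ore_regular_Weyl weyl_op_in_jacobian
      by (intro J.ring_incl_imp_subring)
        (auto simp: Jacobian_algebra_eq Weyl_algebra_eq right_Ore_regular_def)
    show "right_Ore_regular (?J\<lparr>carrier := range weyl_op\<rparr>) (regular ?A)"
      using right_Ore_regular_Weyl A_eq by metis
    show "c \<odot>\<^bsub>?J\<^esub> x \<in> carrier ?J" if "x \<in> carrier ?J" for c x
      using that JE(6) by (simp add: Jacobian_algebra_eq)
    show "c \<odot>\<^bsub>?J\<^esub> x \<in> range weyl_op" if "x \<in> range weyl_op" for c x
      using that AE(6) by (simp add: Jacobian_algebra_eq)
    show "(c \<odot>\<^bsub>?J\<^esub> x) \<otimes>\<^bsub>?J\<^esub> y = c \<odot>\<^bsub>?J\<^esub> (x \<otimes>\<^bsub>?J\<^esub> y)" for c x y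
      by (simp add: Jacobian_algebra_eq fun_eq_iff)
    show "\<exists>b\<in>range weyl_op. t \<otimes>\<^bsub>?J\<^esub> b \<in> right_regular ?J \<inter> regular ?A" if t: "t \<in> regular ?A" for t
    proof -
      obtain P where P: "P \<noteq> 0" "t = weyl_op P"
        using t by (auto simp: regular_Weyl_algebra)
      obtain U where U: "U \<noteq> 0" "inj (weyl_op P \<circ> weyl_op U)"
        using P(1) by (rule weyl_op_right_multiple_inj)
      have "t \<otimes>\<^bsub>?J\<^esub> weyl_op U \<in> right_regular ?J \<inter> regular ?A"
        using inj_common[OF refl U(1) P(1) U(2)] by (simp add: P(2) Jacobian_algebra_eq)
      then show ?thesis by blast
    qed
    show "\<exists>b\<in>range weyl_op. r \<otimes>\<^bsub>?J\<^esub> b \<in> range weyl_op \<and> s \<otimes>\<^bsub>?J\<^esub> b \<in> right_regular ?J \<inter> regular ?A"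
      if r: "r \<in> carrier ?J" and s: "s \<in> right_regular ?J" for r s
    proof -
      obtain U A B where U: "U \<noteq> 0" "B \<noteq> 0" "r \<circ> weyl_op U = weyl_op A" "s \<circ> weyl_op U = weyl_op B"
        using r s by (auto simp: Jacobian_algebra_eq elim: right_regular_clear)
      \<comment> \<open>B \<noteq> 0 only makes s U regular in A_1; the factor W also makes it
        injective, hence right regular in J.\<close>
      obtain W where W: "W \<noteq> 0" "inj (weyl_op B \<circ> weyl_op W)"
        using U(2) by (rule weyl_op_right_multiple_inj)
      have "r \<circ> weyl_op (weyl_mult U W) = weyl_op (weyl_mult A W)"
        unfolding weyl_op_comp[symmetric] U(3)[symmetric] by (simp add: comp_assoc)
      moreover have "s \<circ> weyl_op (weyl_mult U W) = weyl_op B \<circ> weyl_op W"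
        unfolding weyl_op_comp[symmetric] U(4)[symmetric] by (simp add: comp_assoc)
      ultimately show ?thesis
        using inj_common[OF refl W(1) U(2) W(2)]
        by (intro bexI[of _ "weyl_op (weyl_mult U W)"]) (simp_all add: J_mult)
    qed
  qed
  then show ?thesis
    unfolding right_regular_right_quotient_ring_def classical_right_quotient_ring_def
      largest_right_regular_denominator_set_eq[OF right_Ore_regular_Jacobian] A_eq[symmetric] .
qed

end
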